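(* Let $d=1$ and $\kappa\in(0,1/2]$. There exists a constant $\lambda_1\in(0,1)$, depending only on the model constants, such that for any random walk in an i.i.d. random environment on $\mathbb Z$ with environment law $\mathbb P=\mu^{\otimes\mathbb Z}$, $\mu$ a probability measure on $\mathcal P_\kappa$, the following assertions are equivalent: (i) There exist $L_0>0$ and a function $\varphi:[0,\infty]\to[0,\infty]$ with $\lim_{M\to\infty}\varphi(M)=0$ such that for all $L\ge L_0$, $$P_0[X_{T_{U_L}}\notin\partial^+U_L]\le\varphi(L),$$ where $U_L=\{x\in\mathbb Z:|x|<L\}$ and $\partial^+U_L=\{x\in\partial U_L: x\ge L\}$ is the right part of the boundary of $U_L$. (ii) Condition $(\mathcal W_{c,M})|e_1$ (defined with the constant $\lambda_1$) holds for some positive constants $c$ and $M$ with $M>1/\lambda_1$. (iii) The walk is transient along direction $e_1$: $P_0[\lim_{n\to\infty}X_n\cdot e_1=\infty]=1$. (iv) Condition $(T)|e_1$ holds.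
   Context: Here $d=1$ and $e_1=1$. $\mathcal P_\kappa=\{(z_1,z_2)\in\mathbb R^2:z_1+z_2=1,\ z_i\ge\kappa\}$, coordinates indexed by $e\in\{1,-1\}$; $\Omega=\mathcal P_\kappa^{\mathbb Z}$, $\omega=(\omega(x,e))_{x\in\mathbb Z,e=\pm1}$. The quenched law $P_{x,\omega}$ is the law of the Markov chain $(X_n)_{n\ge0}$ on $\mathbb Z$ with $X_0=x$ and $P_{x,\omega}[X_{n+1}=X_n+e\mid X_n]=\omega(X_n,e)$. The annealed law is $P_x=\mathbb P\times P_{x,\omega}$ (semidirect product); $\mathbb E$ is the expectation of $\mathbb P$. For $V\subset\mathbb Z$, $\partial V=\{z\in V^c:\ |z-v|=1\text{ for some }v\in V\}$. $T_A=\inf\{n\ge0:X_n\notin A\}$; for $\ell\in\mathbb S^0=\{1,-1\}$, $T^\ell_L=\inf\{n\ge0:X_n\cdot\ell\ge L\}$ and $\widetilde T^\ell_L=\inf\{n\ge0:X_n\cdot\ell\le L\}$. Condition $(T)|e_1$: for each $b>0$ there is a neighbourhood $\mathcal U$ of $e_1$ in $\mathbb S^0$ such that for each $\ell'\in\mathcal U$, $\limsup_{L\to\infty}L^{-1}\log P_0[\widetilde T^{\ell'}_{-bL}<T^{\ell'}_L]<0$. Condition $(\mathcal W_{c,M})|e_1$ in dimension one: with $\widetilde B_1(c,M)=[0,M]\cap\mathbb Z$, $B_2(c,M)=(-M,(1+\tfrac1{11})M)\cap\mathbb Z$ and $\partial^+B_2(c,M)=\partial B_2(c,M)\cap\{z:z\ge(1+\tfrac1{11})M\}$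 (in dimension one $c$ plays no role), where $M>1/\lambda_1$, one has $$\mathbb E\Big[\sup_{x\in\widetilde B_1(c,M)}P_{x,\omega}\big[X_{T_{B_2(c,M)}}\notin\partial^+B_2(c,M)\big]\Big]<\lambda_1.$$ *)

theory Defs
  imports "HOL-Probability.Probability"
begin

text \<open>A site vector is a pair: \<^term>\<open>fst z\<close> is the coordinate with index \<open>e = 1\<close>,
  \<^term>\<open>snd z\<close> the one with index \<open>e = -1\<close>.\<close>

definition site_simplex :: "real \<Rightarrow> (real \<times> real) set" where
  "site_simplex \<kappa> = {z. fst z + snd z = 1 \<and> \<kappa> \<le> fst z \<and> \<kappa> \<le> snd z}"

definition site_law :: "real \<Rightarrow> (real \<times> real) measure \<Rightarrow> bool" where
  "site_law \<kappa> \<mu> \<longleftrightarrow> prob_space \<mu> \<and> sets \<mu> = sets (restrict_space borel (site_simplex \<kappa>))"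

definition env_law :: "(real \<times> real) measure \<Rightarrow> (int \<Rightarrow> real \<times> real) measure" where
  "env_law \<mu> = PiM UNIV (\<lambda>_. \<mu>)"

definition jump_prob :: "(int \<Rightarrow> real \<times> real) \<Rightarrow> int \<Rightarrow> int \<Rightarrow> real" where
  "jump_prob \<omega> y e = (if e = 1 then fst (\<omega> y) else if e = -1 then snd (\<omega> y) else 0)"

abbreviation path_space :: "(nat \<Rightarrow> int) measure" where
  "path_space \<equiv> PiM UNIV (\<lambda>_. count_space UNIV)"

definition step_law :: "(int \<Rightarrow> real \<times> real) \<Rightarrow> int \<Rightarrow> int measure" where
  "step_law \<omega> y = density (count_space UNIV) (\<lambda>z. ennreal (jump_prob \<omega> y (z - y)))"

definition walk_kernel ::
  "int \<Rightarrow> (int \<Rightarrow> real \<times> real) \<Rightarrow> nat \<Rightarrow> (nat \<Rightarrow> int) \<Rightarrow> int measure" where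
  "walk_kernel x \<omega> n h = (if n = 0 then return (count_space UNIV) x else step_law \<omega> (h (n - 1)))"

text \<open>The law of the Markov chain is the Ionescu-Tulcea measure of the kernels above, i.e. the
  constant \<open>PF.lim\<close> of the locale \<^locale>\<open>Ionescu_Tulcea\<close>, written out because the locale
  can only be interpreted when \<open>\<omega>\<close> is an environment. Lemma \<open>emeasure_quenched_cylinder\<close> below
  gives its finite-dimensional distributions.\<close>

definition quenched :: "int \<Rightarrow> (int \<Rightarrow> real \<times> real) \<Rightarrow> (nat \<Rightarrow> int) measure" where
  "quenched x \<omega> = projective_family.lim UNIV
     (Ionescu_Tulcea.CI (walk_kernel x \<omega>) (\<lambda>_. count_space UNIV)) (\<lambda>_. count_space UNIV)"

definition annealed ::
  "(real \<times> real) measure \<Rightarrow> int \<Rightarrow> ((int \<Rightarrow> real \<times> real) \<times> (nat \<Rightarrow> int)) measure" where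
  "annealed \<mu> x = env_law \<mu> \<bind>
     (\<lambda>\<omega>. distr (quenched x \<omega>) (env_law \<mu> \<Otimes>\<^sub>M path_space) (\<lambda>X. (\<omega>, X)))"

definition exit_time :: "int set \<Rightarrow> (nat \<Rightarrow> int) \<Rightarrow> enat" where
  "exit_time A X = Inf (enat ` {n. X n \<notin> A})"

definition boundary :: "int set \<Rightarrow> int set" where
  "boundary V = {z. z \<notin> V \<and> (\<exists>v\<in>V. \<bar>z - v\<bar> = 1)}"

text \<open>\<open>X\<close> at its exit time from \<open>A\<close> is not in \<open>B\<close>; paths that never leave \<open>A\<close> are not counted.
  Below \<open>A\<close> is bounded, and then these paths form a null set.\<close>

definition exits_outside :: "int set \<Rightarrow> int set \<Rightarrow> (nat \<Rightarrow> int) \<Rightarrow> bool" where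
  "exits_outside A B X \<longleftrightarrow> exit_time A X < \<infinity> \<and> X (the_enat (exit_time A X)) \<notin> B"

definition hit_ge :: "real \<Rightarrow> real \<Rightarrow> (nat \<Rightarrow> int) \<Rightarrow> enat" where
  "hit_ge l L X = Inf (enat ` {n. of_int (X n) * l \<ge> L})"

definition hit_le :: "real \<Rightarrow> real \<Rightarrow> (nat \<Rightarrow> int) \<Rightarrow> enat" where
  "hit_le l L X = Inf (enat ` {n. of_int (X n) * l \<le> L})"

definition U_box :: "real \<Rightarrow> int set" where
  "U_box L = {x. \<bar>of_int x\<bar> < L}"

definition U_right :: "real \<Rightarrow> int set" where
  "U_right L = {x \<in> boundary (U_box L). of_int x \<ge> L}"

definition cond_decay :: "(real \<times> real) measure \<Rightarrow> bool" where
  "cond_decay \<mu> \<longleftrightarrow>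
    (\<exists>L0>0. \<exists>\<phi> :: ennreal \<Rightarrow> ennreal. (\<phi> \<longlongrightarrow> 0) (at \<infinity>) \<and>
      (\<forall>L\<ge>L0. ennreal (\<P>((\<omega>, X) in annealed \<mu> 0. exits_outside (U_box L) (U_right L) X))
                \<le> \<phi> (ennreal L)))"

text \<open>In dimension one the parameter \<open>c\<close> plays no role; it is kept to match the notation
  of the general condition.\<close>

definition B1 :: "real \<Rightarrow> real \<Rightarrow> int set" where
  "B1 c M = {x. 0 \<le> real_of_int x \<and> real_of_int x \<le> M}"

definition B2 :: "real \<Rightarrow> real \<Rightarrow> int set" where
  "B2 c M = {x. - M < real_of_int x \<and> real_of_int x < (1 + 1/11) * M}"

definition B2_right :: "real \<Rightarrow> real \<Rightarrow> int set" where
  "B2_right c M = boundary (B2 c M) \<inter> {z. real_of_int z \<ge> (1 + 1/11) * M}"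

definition cond_W :: "real \<Rightarrow> (real \<times> real) measure \<Rightarrow> real \<Rightarrow> real \<Rightarrow> bool" where
  "cond_W lam \<mu> c M \<longleftrightarrow>
     prob_space.expectation (env_law \<mu>)
       (\<lambda>\<omega>. SUP x\<in>B1 c M. \<P>(X in quenched x \<omega>. exits_outside (B2 c M) (B2_right c M) X)) < lam"

definition transient_right :: "(real \<times> real) measure \<Rightarrow> bool" where
  "transient_right \<mu> \<longleftrightarrow> \<P>((\<omega>, X) in annealed \<mu> 0. filterlim X at_top sequentially) = 1"

text \<open>Logarithm of a probability with \<open>log 0 = -\<infinity>\<close> (the library has \<open>ln 0 = 0\<close>).\<close>

definition elog :: "real \<Rightarrow> ereal" where
  "elog p = (if p = 0 then -\<infinity> else ereal (ln p))"

definition cond_T :: "(real \<times> real) measure \<Rightarrow> bool" where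
  "cond_T \<mu> \<longleftrightarrow>
    (\<forall>b>0. \<exists>U. openin (top_of_set (sphere (0::real) 1)) U \<and> 1 \<in> U \<and>
      (\<forall>l\<in>U. Limsup at_top (\<lambda>L::real. ereal (1 / L) *
         elog (\<P>((\<omega>, X) in annealed \<mu> 0. hit_le l (- b * L) X < hit_ge l L X))) < 0))"

lemma space_site_law: "site_law \<kappa> \<mu> \<Longrightarrow> space \<mu> = site_simplex \<kappa>"
  unfolding site_law_def by (metis Int_UNIV_right sets_eq_imp_space_eq space_borel space_restrict_space inf_commute)

lemma space_env_law: "site_law \<kappa> \<mu> \<Longrightarrow> \<omega> \<in> space (env_law \<mu>) \<longleftrightarrow> range \<omega> \<subseteq> site_simplex \<kappa>"
  by (auto simp: env_law_def space_PiM space_site_law)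

lemma prob_space_env_law: "site_law \<kappa> \<mu> \<Longrightarrow> prob_space (env_law \<mu>)"
  unfolding env_law_def by (rule prob_space_PiM) (simp add: site_law_def)

lemma prob_space_step_law:
  assumes "range \<omega> \<subseteq> site_simplex \<kappa>" "0 \<le> \<kappa>"
  shows "prob_space (step_law \<omega> y)"
proof (rule prob_spaceI)
  have *: "0 \<le> fst (\<omega> y)" "0 \<le> snd (\<omega> y)" "fst (\<omega> y) + snd (\<omega> y) = 1"
    using assms by (auto simp: site_simplex_def image_subset_iff intro: order_trans)
  have "emeasure (step_law \<omega> y) (space (step_law \<omega> y))
      = (\<integral>\<^sup>+z. ennreal (jump_prob \<omega> y (z - y)) \<partial>count_space UNIV)"
    by (simp add: step_law_def emeasure_density)
  also have "\<dots> = (\<Sum>z\<in>{y - 1, y + 1}. ennreal (jump_prob \<omega> y (z - y)))"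
    by (rule nn_integral_count_space'[of "{y - 1, y + 1}"]) (auto simp: jump_prob_def)
  also have "\<dots> = 1"
    using * by (simp add: jump_prob_def ennreal_plus[symmetric] add.commute del: ennreal_plus)
  finally show "emeasure (step_law \<omega> y) (space (step_law \<omega> y)) = 1" .
qed

lemma Ionescu_Tulcea_walk_kernel:
  assumes "range \<omega> \<subseteq> site_simplex \<kappa>" "0 \<le> \<kappa>"
  shows "Ionescu_Tulcea (walk_kernel x \<omega>) (\<lambda>_. count_space UNIV)"
proof (rule Ionescu_Tulcea.intro)
  show "prob_space (walk_kernel x \<omega> i h)" for i h
    using prob_space_step_law[OF assms] by (auto simp: walk_kernel_def intro!: prob_space_return)
  have step: "step_law \<omega> \<in> measurable (count_space UNIV) (subprob_algebra (count_space UNIV))"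
    using prob_space_step_law[OF assms]
    by (auto simp: space_subprob_algebra step_law_def intro!: prob_space_imp_subprob_space)
  show "walk_kernel x \<omega> i \<in>
      measurable (PiM {0..<i} (\<lambda>_. count_space UNIV)) (subprob_algebra (count_space UNIV))" for i
  proof (cases "i = 0")
    case True
    then show ?thesis
      by (auto simp: walk_kernel_def[abs_def] space_subprob_algebra
          intro!: measurable_const prob_space_imp_subprob_space prob_space_return)
  next
    case False
    then have "(\<lambda>h. h (i - 1)) \<in> measurable (PiM {0..<i} (\<lambda>_. count_space UNIV)) (count_space UNIV)"
      by (intro measurable_component_singleton) auto
    from measurable_compose[OF this step] False show ?thesis
      by (simp add: walk_kernel_def[abs_def])
  qed
qed

lemma sets_quenched:
  assumes "range \<omega> \<subseteq> site_simplex \<kappa>" "0 \<le> \<kappa>"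
  shows "sets (quenched x \<omega>) = sets path_space"
proof -
  interpret Ionescu_Tulcea "walk_kernel x \<omega>" "\<lambda>_. count_space UNIV"
    by (rule Ionescu_Tulcea_walk_kernel[OF assms])
  show ?thesis
    unfolding quenched_def by (rule PF.sets_lim)
qed

lemma prob_space_quenched:
  assumes "range \<omega> \<subseteq> site_simplex \<kappa>" "0 \<le> \<kappa>"
  shows "prob_space (quenched x \<omega>)"
proof -
  interpret Ionescu_Tulcea "walk_kernel x \<omega>" "\<lambda>_. count_space UNIV"
    by (rule Ionescu_Tulcea_walk_kernel[OF assms])
  have "space (CI {}) = space (PiM {} (\<lambda>_. count_space UNIV))"
    by (simp add: CI_def)
  then have "emeasure PF.lim (PF.emb UNIV {} (space (PiM {} (\<lambda>_. count_space UNIV)))) = 1"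
    using prob_space.emeasure_space_1[OF PF.prob_space_P[of "{}"]] by (subst lim) auto
  then show ?thesis
    unfolding quenched_def by (intro prob_spaceI) (simp add: PF.space_lim space_PiM prod_emb_def vimage_def fun_eq_iff)
qed

lemma emeasure_walk_kernel:
  "emeasure (walk_kernel x \<omega> i h) {k} =
     (if i = 0 then indicator {x} k else ennreal (jump_prob \<omega> (h (i - 1)) (k - h (i - 1))))"
  by (auto simp: walk_kernel_def step_law_def emeasure_density nn_integral_count_space_indicator[symmetric]
      split: split_indicator)

lemma emeasure_quenched_cylinder:
  assumes "range \<omega> \<subseteq> site_simplex \<kappa>" "0 \<le> \<kappa>"
  shows "emeasure (quenched x \<omega>) {X. \<forall>i\<le>n. X i = w i} =
    (if w 0 = x then \<Prod>i<n. ennreal (jump_prob \<omega> (w i) (w (Suc i) - w i)) else 0)"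
proof -
  interpret Ionescu_Tulcea "walk_kernel x \<omega>" "\<lambda>_. count_space UNIV"
    by (rule Ionescu_Tulcea_walk_kernel[OF assms])
  let ?M = "\<lambda>_::nat. count_space (UNIV :: int set)"
  have sing: "{restrict w {0..<m}} \<in> sets (PiM {0..<m} ?M)" for m
  proof -
    have "{restrict w {0..<m}} = PiE {0..<m} (\<lambda>i. {w i})"
      by (auto simp: PiE_iff fun_eq_iff extensional_def)
    then show ?thesis
      by (simp only:) (rule sets_PiM_I_finite, auto)
  qed
  have C: "emeasure (C 0 m (\<lambda>_. undefined)) {restrict w {0..<m}} =
      (\<Prod>i<m. emeasure (walk_kernel x \<omega> i w) {w i})" for m
  proof (induction m)
    case 0
    show ?case by (simp add: restrict_def PiM_empty)
  next
    case (Suc m)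
    have eP: "emeasure (eP m h) {restrict w {0..<Suc m}} =
        emeasure (walk_kernel x \<omega> m w) {w m} * indicator {restrict w {0..<m}} h"
      if h: "h \<in> space (PiM {0..<m} ?M)" for h
    proof (cases "h = restrict w {0..<m}")
      case True
      have "(\<lambda>x. h(m := x)) -` {restrict w {0..<Suc m}} \<inter> space (?M m) = {w m}"
      proof (intro set_eqI iffI)
        fix y assume "y \<in> (\<lambda>x. h(m := x)) -` {restrict w {0..<Suc m}} \<inter> space (?M m)"
        then have "(h(m := y)) m = restrict w {0..<Suc m} m" by simp
        then show "y \<in> {w m}" by simp
      qed (use True in \<open>auto simp: fun_eq_iff restrict_def\<close>)
      moreover have "walk_kernel x \<omega> m h = walk_kernel x \<omega> m w"
        using True by (simp add: walk_kernel_def)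
      ultimately show ?thesis
        using True emeasure_eP[OF h sing[of "Suc m"]] by simp
    next
      case False
      have "(\<lambda>x. h(m := x)) -` {restrict w {0..<Suc m}} = {}"
      proof (rule ccontr)
        assume "(\<lambda>x. h(m := x)) -` {restrict w {0..<Suc m}} \<noteq> {}"
        then obtain y where y: "h(m := y) = restrict w {0..<Suc m}" by auto
        have "h i = restrict w {0..<m} i" for i
          using fun_cong[OF y, of i] h
          by (cases "i < m") (auto simp: space_PiM PiE_iff extensional_def split: if_splits)
        with False show False by auto
      qed
      with False show ?thesis
        using emeasure_eP[OF h sing[of "Suc m"]] by simp
    qed
    have "emeasure (C 0 (Suc m) (\<lambda>_. undefined)) {restrict w {0..<Suc m}} =
        (\<integral>\<^sup>+h. emeasure (eP m h) {restrict w {0..<Suc m}} \<partial>C 0 m (\<lambda>_. undefined))"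
    proof -
      have u: "(\<lambda>_. undefined) \<in> space (PiM {0..<0} ?M)"
        by (simp add: space_PiM)
      have e: "eP m \<in> measurable (C 0 m (\<lambda>_. undefined)) (subprob_algebra (PiM {0..<Suc m} ?M))"
        using measurable_eP[of m] sets_C[OF u, of m] by (simp cong: measurable_cong_sets)
      show ?thesis
        using emeasure_bind[OF prob_space.not_empty[OF prob_space_C[OF u]] e sing] by simp
    qed
    also have "\<dots> = (\<integral>\<^sup>+h. emeasure (walk_kernel x \<omega> m w) {w m} * indicator {restrict w {0..<m}} h
        \<partial>C 0 m (\<lambda>_. undefined))"
      using space_C[of "\<lambda>_. undefined" 0 m] by (intro nn_integral_cong eP) simp
    also have "\<dots> = emeasure (walk_kernel x \<omega> m w) {w m} *
        emeasure (C 0 m (\<lambda>_. undefined)) {restrict w {0..<m}}"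
      using sing[of m] sets_C[of "\<lambda>_. undefined" 0 m] by (intro nn_integral_cmult_indicator) simp
    finally show ?case
      by (simp only: Suc.IH prod.lessThan_Suc mult.commute)
  qed
  have "restrict X {0..<Suc n} = restrict w {0..<Suc n} \<longleftrightarrow> (\<forall>i\<le>n. X i = w i)" for X
  proof
    assume eq: "restrict X {0..<Suc n} = restrict w {0..<Suc n}"
    show "\<forall>i\<le>n. X i = w i"
    proof (intro allI impI)
      fix i assume "i \<le> n"
      with fun_cong[OF eq, of i] show "X i = w i" by simp
    qed
  qed (auto intro: restrict_ext)
  then have "{X. \<forall>i\<le>n. X i = w i} = PF.emb UNIV {0..<Suc n} {restrict w {0..<Suc n}}"
    by (auto simp: prod_emb_def)
  then have "emeasure (quenched x \<omega>) {X. \<forall>i\<le>n. X i = w i} =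
      emeasure (CI {0..<Suc n}) {restrict w {0..<Suc n}}"
    unfolding quenched_def using lim[OF _ sing[of "Suc n"]] by simp
  also have "\<dots> = emeasure (C 0 (Suc n) (\<lambda>_. undefined)) {restrict w {0..<Suc n}}"
    using emeasure_CI[of "{0..<Suc n}" "Suc n", OF _ sing] sets.sets_into_space[OF sing[of "Suc n"]]
    by (simp add: prod_emb_id del: C.simps)
  also have "\<dots> = (\<Prod>i<Suc n. emeasure (walk_kernel x \<omega> i w) {w i})"
    by (rule C)
  also have "\<dots> = (if w 0 = x then \<Prod>i<n. ennreal (jump_prob \<omega> (w i) (w (Suc i) - w i)) else 0)"
    by (simp only: prod.lessThan_Suc_shift emeasure_walk_kernel) (auto split: split_indicator)
  finally show ?thesis .
qed

lemma measurable_quenched: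
  assumes "site_law \<kappa> \<mu>" "0 \<le> \<kappa>"
  shows "quenched x \<in> measurable (env_law \<mu>) (subprob_algebra path_space)"
proof -
  define cyl :: "nat \<Rightarrow> (nat \<Rightarrow> int) \<Rightarrow> (nat \<Rightarrow> int) set"
    where "cyl n w = {X. \<forall>i\<le>n. X i = w i}" for n w
  define G where "G = insert {} (range (case_prod cyl))"
  have cyl_sets: "cyl n w \<in> sets path_space" for n w
  proof -
    have "cyl n w = {X \<in> space path_space. \<forall>i\<in>{..n}. X i = w i}"
      by (auto simp: cyl_def space_PiM)
    also have "\<dots> \<in> sets path_space" by measurable
    finally show ?thesis .
  qed
  have Int: "Int_stable G"
  proof (rule Int_stableI)
    fix a b assume ab: "a \<in> G" "b \<in> G"
    show "a \<inter> b \<in> G"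
    proof (cases "a \<inter> b = {}")
      case False
      obtain n w m v where *: "a = cyl n w" "b = cyl m v"
        using ab False by (auto simp: G_def)
      moreover obtain z where "z \<in> cyl n w" "z \<in> cyl m v"
        using False * by blast
      ultimately have "a \<inter> b = cyl (max n m) z"
        by (auto simp: cyl_def le_max_iff_disj)
      then show ?thesis by (auto simp: G_def intro: range_eqI[where x="(max n m, z)"])
    qed (simp add: G_def)
  qed
  have gen: "sets path_space = sigma_sets UNIV G"
  proof (rule antisym)
    show "sigma_sets UNIV G \<subseteq> sets path_space"
    proof -
      have "G \<subseteq> sets path_space" using cyl_sets by (auto simp: G_def)
      then have "sigma_sets (space path_space) G \<subseteq> sets path_space" by (rule sets.sigma_sets_subset)
      then show ?thesis by (simp add: space_PiM)
    qed
    interpret S: sigma_algebra UNIV "sigma_sets UNIV G"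
      by (rule sigma_algebra_sigma_sets) simp
    have "{X. X i \<in> A} \<in> sigma_sets UNIV G" for i :: nat and A :: "int set"
    proof -
      have "{X. X i \<in> A} = (\<Union>l\<in>{l. length l = Suc i \<and> l ! i \<in> A}. cyl i (nth l))"
      proof (intro set_eqI iffI)
        fix X :: "nat \<Rightarrow> int" assume "X \<in> {X. X i \<in> A}"
        then show "X \<in> (\<Union>l\<in>{l. length l = Suc i \<and> l ! i \<in> A}. cyl i (nth l))"
          by (intro UN_I[of "map X [0..<Suc i]"]) (auto simp: cyl_def nth_append simp del: upt_Suc)
      qed (auto simp: cyl_def)
      also have "\<dots> \<in> sigma_sets UNIV G"
        by (intro S.countable_UN' uncountable_def[THEN iffD1] sigma_sets.Basic)
           (auto simp: G_def)
      finally show ?thesis .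
    qed
    then show "sets path_space \<subseteq> sigma_sets UNIV G"
      using S.sigma_sets_subset[of "{{f. f i \<in> A} |(i::nat) (A::int set). True}"]
      by (auto simp: sets_PiM_single)
  qed
  show ?thesis
  proof (rule measurable_subprob_algebra_generated[OF gen Int])
    fix \<omega> assume "\<omega> \<in> space (env_law \<mu>)"
    then have r: "range \<omega> \<subseteq> site_simplex \<kappa>"
      using space_env_law[OF assms(1)] by simp
    show "subprob_space (quenched x \<omega>)"
      using prob_space_quenched[OF r assms(2)] by (rule prob_space_imp_subprob_space)
    show "sets (quenched x \<omega>) = sets path_space"
      by (rule sets_quenched[OF r assms(2)])
  next
    have [measurable]: "(\<lambda>\<omega>. jump_prob \<omega> y e) \<in> borel_measurable (env_law \<mu>)" for y e
    proof -
      have id: "(\<lambda>z. z) \<in> measurable \<mu> borel"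
        using assms(1) by (simp add: site_law_def measurable_restrict_space1 cong: measurable_cong_sets)
      have "(\<lambda>\<omega>. \<omega> y) \<in> measurable (env_law \<mu>) \<mu>"
        unfolding env_law_def by (rule measurable_component_singleton) simp
      from measurable_compose[OF this id]
      have "(\<lambda>\<omega>. \<omega> y) \<in> measurable (env_law \<mu>) (borel :: (real \<times> real) measure)" .
      then have "(\<lambda>\<omega>. fst (\<omega> y)) \<in> borel_measurable (env_law \<mu>)"
        "(\<lambda>\<omega>. snd (\<omega> y)) \<in> borel_measurable (env_law \<mu>)"
        by (rule measurable_compose, simp add: borel_measurable_continuous_onI continuous_intros)+
      then show ?thesis
        by (simp add: jump_prob_def)
    qed
    have cyl: "(\<lambda>\<omega>. emeasure (quenched x \<omega>) (cyl n w)) \<in> borel_measurable (env_law \<mu>)" for n w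
    proof -
      have "(\<lambda>\<omega>. if w 0 = x then \<Prod>i<n. ennreal (jump_prob \<omega> (w i) (w (Suc i) - w i)) else 0)
          \<in> borel_measurable (env_law \<mu>)"
        by measurable
      then show ?thesis
        using emeasure_quenched_cylinder[OF _ assms(2)] space_env_law[OF assms(1)]
        by (subst measurable_cong) (auto simp: cyl_def)
    qed
    show "(\<lambda>\<omega>. emeasure (quenched x \<omega>) a) \<in> borel_measurable (env_law \<mu>)" if "a \<in> G" for a
      using that cyl by (auto simp: G_def)
    have "UNIV = (\<Union>k. cyl 0 (\<lambda>_. k))" by (auto simp: cyl_def)
    show "(\<lambda>\<omega>. emeasure (quenched x \<omega>) UNIV) \<in> borel_measurable (env_law \<mu>)"
    proof (subst measurable_cong)
      fix \<omega> assume "\<omega> \<in> space (env_law \<mu>)"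
      then have r: "range \<omega> \<subseteq> site_simplex \<kappa>"
        using space_env_law[OF assms(1)] by simp
      show "emeasure (quenched x \<omega>) UNIV = 1"
        using prob_space.emeasure_space_1[OF prob_space_quenched[OF r assms(2)]]
          sets_eq_imp_space_eq[OF sets_quenched[OF r assms(2)]] by (simp add: space_PiM)
    qed simp
  qed (auto simp: G_def)
qed

lemma emeasure_annealed:
  assumes "site_law \<kappa> \<mu>" "0 \<le> \<kappa>" and A: "A \<in> sets (env_law \<mu> \<Otimes>\<^sub>M path_space)"
  shows "emeasure (annealed \<mu> x) A = (\<integral>\<^sup>+\<omega>. emeasure (quenched x \<omega>) {X. (\<omega>, X) \<in> A} \<partial>env_law \<mu>)"
proof -
  note [measurable] = measurable_quenched[OF assms(1,2)]
  have kernel: "(\<lambda>\<omega>. distr (quenched x \<omega>) (env_law \<mu> \<Otimes>\<^sub>M path_space) (\<lambda>X. (\<omega>, X)))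
      \<in> measurable (env_law \<mu>) (subprob_algebra (env_law \<mu> \<Otimes>\<^sub>M path_space))"
    by (rule measurable_distr2[where M="path_space"]) measurable
  have "emeasure (annealed \<mu> x) A = (\<integral>\<^sup>+\<omega>. emeasure
      (distr (quenched x \<omega>) (env_law \<mu> \<Otimes>\<^sub>M path_space) (\<lambda>X. (\<omega>, X))) A \<partial>env_law \<mu>)"
    unfolding annealed_def
    by (rule emeasure_bind[OF prob_space.not_empty[OF prob_space_env_law[OF assms(1)]] kernel A])
  also have "\<dots> = (\<integral>\<^sup>+\<omega>. emeasure (quenched x \<omega>) {X. (\<omega>, X) \<in> A} \<partial>env_law \<mu>)"
  proof (rule nn_integral_cong)
    fix \<omega> assume \<omega>: "\<omega> \<in> space (env_law \<mu>)"
    then have "sets (quenched x \<omega>) = sets path_space"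
      using sets_quenched[OF _ assms(2)] space_env_law[OF assms(1)] by simp
    then have "(\<lambda>X. (\<omega>, X)) \<in> measurable (quenched x \<omega>) (env_law \<mu> \<Otimes>\<^sub>M path_space)"
      "space (quenched x \<omega>) = UNIV"
      using \<omega> measurable_Pair1'[OF \<omega>, of path_space]
      by (auto simp: space_PiM cong: measurable_cong_sets dest: sets_eq_imp_space_eq)
    then show "emeasure (distr (quenched x \<omega>) (env_law \<mu> \<Otimes>\<^sub>M path_space) (\<lambda>X. (\<omega>, X))) A
        = emeasure (quenched x \<omega>) {X. (\<omega>, X) \<in> A}"
      using A by (simp add: emeasure_distr vimage_def)
  qed
  finally show ?thesis .
qed

end

theory Submission
  imports Defs
begin

text \<open>
  All four conditions hold exactly if the mean \<open>drift\<close> of the logarithm of the odds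
  \<open>\<omega>(x,-1) / \<omega>(x,1)\<close> is negative. The environment enters through its potential, the function on the
  integers whose increments are these logarithms.

  In a fixed environment, the Markov property at time one makes exit probabilities harmonic,
  and a harmonic function on an interval is determined by its boundary values (\<open>gamblers_ruin\<close>).
  Hence the probability to leave a box on the left is \<open>R / (1 + R)\<close>, where \<open>R\<close> is a ratio of sums of
  exponentials of the potential.

  If the drift is negative, a small power \<open>\<alpha>\<close> of the odds has a mean \<open>r < 1\<close>. Then \<open>min 1 R\<close> is bounded
  by a sum of truncated products of odds over at least \<open>a\<close> sites, where \<open>a\<close> is the distance to the
  left end of the box, and its mean is at most \<open>r ^ a / (1 - r)\<close>, wherever the right end
  is (\<open>exit_left_decay\<close>). The exit conditions follow. For transience, the quenched probability
  of being at or below \<open>y\<close> infinitely often is bounded and harmonic on all of the integers. Such a function is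
  almost surely constant (\<open>often_below_start\<close>), and the exit bound makes it small far to the right.

  If the drift is nonnegative, the mean probability of leaving \<open>(-n, n)\<close> on the left is bounded below
  by a constant that depends on \<open>\<kappa>\<close> only, and this constant serves as \<open>\<lambda>\<^sub>1\<close>; so each condition
  fails. The reason is a symmetry. Here \<open>R\<close> is the exponential of the potential increment \<open>Z\<close> over the
  left half of the box, times \<open>G' / G\<close>, where \<open>G\<close> and \<open>G'\<close> are the resistances of the
  left and the right half, computed by the same formula from the two halves of the environment. Let
  \<open>Z'\<close> be the increment over the right half. Since \<open>(Z, G)\<close> and \<open>(Z', G')\<close> are independent with
  the same law, the event \<open>Z \<ge> -2\<close>, \<open>Z' \<ge> -2\<close>, \<open>G' \<ge> G\<close> has at least half the probability of
  \<open>Z \<ge> -2\<close>, \<open>Z' \<ge> -2\<close> (\<open>exit_ratio_not_small\<close>). It remains to bound \<open>P (Z \<ge> -2)\<close> from below,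
  uniformly in \<open>n\<close> and in the law of the environment. As \<open>\<bar>log odds\<bar> \<le> - ln \<kappa>\<close>, this is a comparison
  of the second and fourth moments of a sum of bounded centred variables
  (\<open>centred_sum_not_negative\<close>).
\<close>

section \<open>The Markov property at time one\<close>

lemma case_nat_measurable_path_space [measurable]:
  "case_nat x \<in> measurable path_space path_space"
proof (rule measurable_PiM_single')
  show "(\<lambda>X. case_nat x X i) \<in> measurable path_space (count_space UNIV)" for i
    by (cases i) auto
qed (auto simp: space_PiM)

lemma cylinder_in_sets [measurable]: "{X :: nat \<Rightarrow> int. \<forall>i\<le>n. X i = w i} \<in> sets path_space"
proof -
  have "{X :: nat \<Rightarrow> int. \<forall>i\<le>n. X i = w i} = {X \<in> space path_space. \<forall>i\<in>{..n}. X i = w i}"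
    by (auto simp: space_PiM)
  also have "\<dots> \<in> sets path_space" by measurable
  finally show ?thesis .
qed

text \<open>Every event that depends on finitely many coordinates is a countable disjoint union of
  cylinders that fix an initial segment of the path; so these cylinders determine the law.\<close>

lemma path_measure_eqI:
  fixes M N :: "(nat \<Rightarrow> int) measure"
  assumes [measurable_cong]: "sets M = sets path_space" "sets N = sets path_space"
    and fin: "finite_measure M"
    and eq: "\<And>n w. emeasure M {X. \<forall>i\<le>n. X i = w i} = emeasure N {X. \<forall>i\<le>n. X i = w i}"
  shows "M = N"
proof (rule measure_eqI_PiM_infinite[OF assms(1,2) _ fin])
  fix A :: "nat \<Rightarrow> int set" and J :: "nat set"
  assume J: "finite J"
  obtain n where n: "J \<subseteq> {..n}"
    using J finite_nat_iff_bounded_le by blast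
  let ?cyl = "\<lambda>l. {X :: nat \<Rightarrow> int. \<forall>i\<le>n. X i = l ! i}"
  define I where "I = {l :: int list. length l = Suc n \<and> (\<forall>j\<in>J. l ! j \<in> A j)}"
  have E: "prod_emb UNIV (\<lambda>_. count_space UNIV) J (Pi\<^sub>E J A) = (\<Union>l\<in>I. ?cyl l)"
  proof (intro set_eqI iffI)
    fix X assume "X \<in> prod_emb UNIV (\<lambda>_. count_space UNIV) J (Pi\<^sub>E J A)"
    then have "\<forall>j\<in>J. X j \<in> A j"
      by (auto simp: prod_emb_def PiE_iff)
    then show "X \<in> (\<Union>l\<in>I. ?cyl l)"
      using n by (intro UN_I[of "map X [0..<Suc n]"])
        (force simp: I_def nth_append less_Suc_eq_le simp del: upt_Suc)+
  qed (use n in \<open>fastforce simp: prod_emb_def PiE_iff I_def\<close>)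
  have disj: "disjoint_family_on ?cyl I"
  proof (unfold disjoint_family_on_def, intro ballI impI)
    fix l l' assume l: "l \<in> I" "l' \<in> I" "l \<noteq> l'"
    then obtain i where "i \<le> n" "l ! i \<noteq> l' ! i"
      using nth_equalityI[of l l'] by (auto simp: I_def less_Suc_eq_le)
    then show "?cyl l \<inter> ?cyl l' = {}" by auto
  qed
  have "emeasure L (\<Union>l\<in>I. ?cyl l) = (\<integral>\<^sup>+l. emeasure L (?cyl l) \<partial>count_space I)"
    if "sets L = sets path_space" for L
    using that by (intro emeasure_UN_countable disj) auto
  then show "emeasure M (prod_emb UNIV (\<lambda>_. count_space UNIV) J (Pi\<^sub>E J A)) =
      emeasure N (prod_emb UNIV (\<lambda>_. count_space UNIV) J (Pi\<^sub>E J A))"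
    unfolding E using assms(1,2) eq by simp
qed

lemma space_quenched:
  "range \<omega> \<subseteq> site_simplex \<kappa> \<Longrightarrow> 0 \<le> \<kappa> \<Longrightarrow> space (quenched x \<omega>) = UNIV"
  using sets_eq_imp_space_eq[OF sets_quenched] by (simp add: space_PiM)

text \<open>The walk makes one step by \<^const>\<open>step_law\<close> and then starts afresh: both sides give each
  cylinder the same product of jump probabilities.\<close>

lemma quenched_first_step:
  assumes \<omega>: "range \<omega> \<subseteq> site_simplex \<kappa>" "0 \<le> \<kappa>"
  shows "quenched x \<omega> =
    step_law \<omega> x \<bind> (\<lambda>y. distr (quenched y \<omega>) path_space (case_nat x))" (is "_ = ?N")
    and "A \<in> sets path_space \<Longrightarrow> emeasure (quenched x \<omega>) A =
      (\<integral>\<^sup>+y. emeasure (quenched y \<omega>) (case_nat x -` A) \<partial>step_law \<omega> x)"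
proof -
  note sets_q = sets_quenched[OF \<omega>] and space_q = space_quenched[OF \<omega>]
  interpret S: prob_space "step_law \<omega> x" by (rule prob_space_step_law[OF \<omega>])
  have sets_S [measurable_cong]: "sets (step_law \<omega> x) = sets (count_space UNIV)"
    by (simp add: step_law_def)
  have shift: "case_nat x \<in> measurable (quenched y \<omega>) path_space" for y
    using measurable_cong_sets[OF sets_q refl] case_nat_measurable_path_space by blast
  have kernel: "(\<lambda>y. distr (quenched y \<omega>) path_space (case_nat x))
      \<in> measurable (step_law \<omega> x) (subprob_algebra path_space)"
    using prob_space.prob_space_distr[OF prob_space_quenched[OF \<omega>] shift]
    by (auto simp: measurable_def space_subprob_algebra step_law_def
        intro!: prob_space_imp_subprob_space)
  have N: "emeasure ?N B = (\<integral>\<^sup>+y. emeasure (quenched y \<omega>) (case_nat x -` B) \<partial>step_law \<omega> x)"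
    if "B \<in> sets path_space" for B
    using emeasure_bind[OF S.not_empty kernel that] that shift
    by (simp add: emeasure_distr space_q)
  show eq: "quenched x \<omega> = ?N"
  proof (rule path_measure_eqI)
    show "sets (quenched x \<omega>) = sets path_space" by (rule sets_q)
    show "sets ?N = sets path_space"
      by (rule sets_bind[OF _ S.not_empty]) auto
    show "finite_measure (quenched x \<omega>)"
      using prob_space_quenched[OF \<omega>] by (simp add: prob_space_def)
    fix n w
    let ?C = "\<lambda>n w. {X :: nat \<Rightarrow> int. \<forall>i\<le>n. X i = w i}"
    have N': "emeasure ?N (?C n w) =
        (\<integral>\<^sup>+y. emeasure (quenched y \<omega>) (case_nat x -` ?C n w) \<partial>step_law \<omega> x)"
      by (rule N) (rule cylinder_in_sets)
    show "emeasure (quenched x \<omega>) (?C n w) = emeasure ?N (?C n w)"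
    proof (cases "w 0 = x")
      case False
      then have empty: "case_nat x -` ?C n w = {}" by (auto intro!: exI[of _ 0])
      have "emeasure ?N (?C n w) = 0" unfolding N' empty by simp
      with False show ?thesis
        by (simp add: emeasure_quenched_cylinder[OF \<omega>])
    next
      case True
      show ?thesis
      proof (cases n)
        case 0
        then have "case_nat x -` ?C n w = UNIV" using True by auto
        moreover have "emeasure (quenched y \<omega>) UNIV = 1" for y
          using prob_space.emeasure_space_1[OF prob_space_quenched[OF \<omega>]] by (simp add: space_q)
        ultimately have "emeasure ?N (?C n w) = 1"
          using S.emeasure_space_1 unfolding N' by simp
        then show ?thesis
          using 0 True emeasure_quenched_cylinder[OF \<omega>, of x n w] by simp
      next
        case (Suc m)
        have pre: "case_nat x -` ?C n w = ?C m (\<lambda>i. w (Suc i))"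
          using True Suc by (simp add: set_eq_iff less_Suc_eq_le[symmetric] All_less_Suc2)
        have cyl: "emeasure (quenched y \<omega>) (?C m (\<lambda>i. w (Suc i))) = (\<Prod>i<m. ennreal (jump_prob \<omega>
            (w (Suc i)) (w (Suc (Suc i)) - w (Suc i)))) * indicator {w 1} y" for y
          by (simp add: emeasure_quenched_cylinder[OF \<omega>])
        have "emeasure ?N (?C n w) = (\<integral>\<^sup>+y. (\<Prod>i<m. ennreal (jump_prob \<omega> (w (Suc i))
            (w (Suc (Suc i)) - w (Suc i)))) * indicator {w 1} y \<partial>step_law \<omega> x)"
          by (simp only: N' pre cyl)
        also have "\<dots> = (\<Prod>i<m. ennreal (jump_prob \<omega> (w (Suc i))
            (w (Suc (Suc i)) - w (Suc i)))) * emeasure (step_law \<omega> x) {w 1}"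
          by (rule nn_integral_cmult_indicator) (simp add: sets_S)
        also have "emeasure (step_law \<omega> x) {w 1} = ennreal (jump_prob \<omega> x (w 1 - x))"
          using emeasure_walk_kernel[of x \<omega> 1 "\<lambda>_. x" "w 1"] by (simp add: walk_kernel_def)
        finally show ?thesis
          using True Suc
          by (simp add: emeasure_quenched_cylinder[OF \<omega>] prod.lessThan_Suc_shift mult.commute
              del: prod.lessThan_Suc)
      qed
    qed
  qed
  show "emeasure (quenched x \<omega>) A =
      (\<integral>\<^sup>+y. emeasure (quenched y \<omega>) (case_nat x -` A) \<partial>step_law \<omega> x)" if "A \<in> sets path_space"
    using N[OF that] eq by simp
qed

lemma measure_quenched_first_step:
  assumes \<omega>: "range \<omega> \<subseteq> site_simplex \<kappa>" "0 \<le> \<kappa>" and A: "A \<in> sets path_space"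
  shows "measure (quenched x \<omega>) A =
    fst (\<omega> x) * measure (quenched (x + 1) \<omega>) (case_nat x -` A) +
    snd (\<omega> x) * measure (quenched (x - 1) \<omega>) (case_nat x -` A)"
proof -
  have *: "0 \<le> fst (\<omega> x)" "0 \<le> snd (\<omega> x)"
    using \<omega> by (auto simp: site_simplex_def image_subset_iff intro: order_trans)
  interpret Q: prob_space "quenched y \<omega>" for y by (rule prob_space_quenched[OF \<omega>])
  let ?A = "case_nat x -` A"
  have "emeasure (quenched x \<omega>) A =
      (\<integral>\<^sup>+y. ennreal (jump_prob \<omega> x (y - x)) * emeasure (quenched y \<omega>) ?A \<partial>count_space UNIV)"
    unfolding quenched_first_step(2)[OF \<omega> A] by (simp add: step_law_def nn_integral_density)
  also have "\<dots> = (\<Sum>y\<in>{x - 1, x + 1}. ennreal (jump_prob \<omega> x (y - x)) * emeasure (quenched y \<omega>) ?A)"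
    by (rule nn_integral_count_space'[of "{x - 1, x + 1}"]) (auto simp: jump_prob_def)
  also have "\<dots> = ennreal (fst (\<omega> x) * measure (quenched (x + 1) \<omega>) ?A +
      snd (\<omega> x) * measure (quenched (x - 1) \<omega>) ?A)"
    using * by (simp add: jump_prob_def Q.emeasure_eq_measure ennreal_mult' ennreal_plus add.commute)
  finally show ?thesis
    using * by (simp add: Q.emeasure_eq_measure del: ennreal_plus)
qed

section \<open>Exit probabilities in a fixed environment\<close>

text \<open>The path visits \<open>D\<close>, and stays in \<open>A\<close> up to that visit. All exit events below have this form
  with \<open>A\<close> an interval, and it fits the Markov property at time one.\<close>

definition reaches_within :: "int set \<Rightarrow> int set \<Rightarrow> (nat \<Rightarrow> int) \<Rightarrow> bool" where
  "reaches_within A D X \<longleftrightarrow> (\<exists>n. X n \<in> D \<and> (\<forall>m<n. X m \<in> A))"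

lemma reaches_within_case_nat:
  "reaches_within A D (case_nat x X) \<longleftrightarrow> x \<in> D \<or> x \<in> A \<and> reaches_within A D X" (is "?L \<longleftrightarrow> ?R")
proof
  assume ?L
  then obtain n where n: "case_nat x X n \<in> D" "\<forall>m<n. case_nat x X m \<in> A"
    by (auto simp: reaches_within_def)
  show ?R
  proof (cases n)
    case (Suc k)
    then have "x \<in> A" "\<forall>m<k. X m \<in> A" using n(2) by (force dest: spec[of _ "Suc _"])+
    with n(1) Suc show ?thesis by (auto simp: reaches_within_def)
  qed (use n in simp)
next
  assume ?R
  then show ?L
  proof (elim disjE conjE)
    assume "x \<in> D"
    then show ?L unfolding reaches_within_def by (intro exI[of _ 0]) simp
  next
    assume "x \<in> A" "reaches_within A D X"
    then obtain n where "X n \<in> D" "\<forall>m<n. X m \<in> A"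
      by (auto simp: reaches_within_def)
    with \<open>x \<in> A\<close> show ?L
      unfolding reaches_within_def by (intro exI[of _ "Suc n"]) (auto split: nat.split)
  qed
qed

lemma reaches_within_in_sets [measurable]: "{X. reaches_within A D X} \<in> sets path_space"
proof -
  have "{X. reaches_within A D X} = {X \<in> space path_space. \<exists>n. X n \<in> D \<and> (\<forall>m<n. X m \<in> A)}"
    by (simp add: reaches_within_def space_PiM)
  also have "\<dots> \<in> sets path_space" by measurable
  finally show ?thesis .
qed

text \<open>Turns the hitting times, which are infima in \<^typ>\<open>enat\<close>, into least indices.\<close>

lemma Inf_enat_image:
  assumes "k \<in> S" "\<And>m. m < k \<Longrightarrow> m \<notin> S"
  shows "Inf (enat ` S) = enat k"
proof (rule antisym)
  show "Inf (enat ` S) \<le> enat k"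
    using assms(1) by (intro Inf_lower imageI)
  show "enat k \<le> Inf (enat ` S)"
    using assms(2) by (intro Inf_greatest) (force simp: not_less[symmetric])
qed

lemma least_element:
  fixes S :: "nat set"
  assumes "S \<noteq> {}"
  obtains k where "k \<in> S" "\<And>m. m < k \<Longrightarrow> m \<notin> S"
proof
  show "(LEAST n. n \<in> S) \<in> S"
    using assms by (metis LeastI ex_in_conv)
  show "m < (LEAST n. n \<in> S) \<Longrightarrow> m \<notin> S" for m
    by (rule not_less_Least)
qed

lemma exits_outside_iff: "exits_outside A B X \<longleftrightarrow> reaches_within A (- A \<inter> - B) X"
proof -
  let ?S = "{n. X n \<notin> A}"
  show ?thesis
  proof (cases "?S = {}")
    case True
    then show ?thesis
      by (auto simp: exits_outside_def reaches_within_def exit_time_def top_enat_def)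
  next
    case False
    obtain k where kS: "k \<in> ?S" "\<And>m. m < k \<Longrightarrow> m \<notin> ?S"
      by (rule least_element[OF False]) blast
    then have k: "X k \<notin> A" "\<And>m. m < k \<Longrightarrow> X m \<in> A" by auto
    have "exits_outside A B X \<longleftrightarrow> X k \<notin> B"
      using Inf_enat_image[OF kS] by (simp add: exits_outside_def exit_time_def)
    also have "\<dots> \<longleftrightarrow> reaches_within A (- A \<inter> - B) X"
    proof
      assume "reaches_within A (- A \<inter> - B) X"
      then obtain n where n: "X n \<notin> A" "X n \<notin> B" "\<forall>m<n. X m \<in> A"
        by (auto simp: reaches_within_def)
      then have "n = k" using k by (meson linorder_neqE_nat)
      with n show "X k \<notin> B" by simp
    qed (use k in \<open>auto simp: reaches_within_def\<close>)
    finally show ?thesis .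
  qed
qed

lemma hit_le_less_hit_ge_iff:
  assumes "lo < hi"
  shows "hit_le 1 lo X < hit_ge 1 hi X \<longleftrightarrow>
    reaches_within {x. lo < of_int x \<and> of_int x < hi} {x. of_int x \<le> lo} X"
proof -
  let ?S = "{n. of_int (X n) \<le> lo}" and ?G = "{n. of_int (X n) \<ge> hi}"
  show ?thesis
  proof (cases "?S = {}")
    case True
    then have "hit_le 1 lo X = \<infinity>" by (auto simp: hit_le_def top_enat_def)
    moreover have "\<not> reaches_within {x. lo < of_int x \<and> of_int x < hi} {x. of_int x \<le> lo} X"
      using True by (auto simp: reaches_within_def)
    ultimately show ?thesis by simp
  next
    case False
    obtain k where kS: "k \<in> ?S" "\<And>m. m < k \<Longrightarrow> m \<notin> ?S"
      by (rule least_element[OF False]) blast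
    then have k: "of_int (X k) \<le> lo" "\<And>m. m < k \<Longrightarrow> lo < of_int (X m)" by (auto simp: not_le)
    have "hit_le 1 lo X = enat k"
      using Inf_enat_image[OF kS] by (simp add: hit_le_def)
    moreover have "enat k < hit_ge 1 hi X \<longleftrightarrow> (\<forall>n\<le>k. n \<notin> ?G)"
    proof (cases "?G = {}")
      case True
      then show ?thesis by (auto simp: hit_ge_def top_enat_def)
    next
      case F: False
      obtain g where g: "g \<in> ?G" "\<And>m. m < g \<Longrightarrow> m \<notin> ?G"
        by (rule least_element[OF F]) blast
      have "hit_ge 1 hi X = enat g"
        using Inf_enat_image[OF g] by (simp add: hit_ge_def)
      moreover have "k < g \<longleftrightarrow> (\<forall>n\<le>k. n \<notin> ?G)"
        using g by (meson le_less_trans not_le)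
      ultimately show ?thesis by simp
    qed
    moreover have "(\<forall>n\<le>k. n \<notin> ?G) \<longleftrightarrow>
        reaches_within {x. lo < of_int x \<and> of_int x < hi} {x. of_int x \<le> lo} X"
    proof
      assume "\<forall>n\<le>k. n \<notin> ?G"
      then show "reaches_within {x. lo < of_int x \<and> of_int x < hi} {x. of_int x \<le> lo} X"
        unfolding reaches_within_def using k by (intro exI[of _ k]) (auto simp: not_le)
    next
      assume "reaches_within {x. lo < of_int x \<and> of_int x < hi} {x. of_int x \<le> lo} X"
      then obtain n where n: "of_int (X n) \<le> lo" "\<forall>m<n. lo < of_int (X m) \<and> of_int (X m) < hi"
        by (auto simp: reaches_within_def)
      then have "n = k" using k by (meson linorder_neqE_nat not_le)
      with n assms show "\<forall>n\<le>k. n \<notin> ?G" by (force simp: le_less)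
    qed
    ultimately show ?thesis by simp
  qed
qed

text \<open>The logarithm of the odds at a site is the increment of the random potential there.\<close>

definition odds :: "real \<times> real \<Rightarrow> real" where
  "odds z = snd z / fst z"

definition odds_prod :: "(int \<Rightarrow> real \<times> real) \<Rightarrow> int \<Rightarrow> nat \<Rightarrow> real" where
  "odds_prod \<omega> s k = (\<Prod>i<k. odds (\<omega> (s + int i)))"

text \<open>In the electrical network of the walk this is the resistance of \<open>n\<close> consecutive edges,
  relative to the first of them.\<close>

definition resistance :: "(int \<Rightarrow> real \<times> real) \<Rightarrow> int \<Rightarrow> nat \<Rightarrow> real" where
  "resistance \<omega> s n = (\<Sum>k<n. odds_prod \<omega> s k)"

lemma odds_prod_0 [simp]: "odds_prod \<omega> s 0 = 1"
  by (simp add: odds_prod_def)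

lemma odds_prod_add: "odds_prod \<omega> s (k + l) = odds_prod \<omega> s k * odds_prod \<omega> (s + int k) l"
proof (induction l)
  case (Suc l)
  then show ?case by (simp add: odds_prod_def add.assoc)
qed (simp add: odds_prod_def)

lemma resistance_add:
  "resistance \<omega> s (k + l) = resistance \<omega> s k + odds_prod \<omega> s k * resistance \<omega> (s + int k) l"
  by (induction l) (simp_all add: resistance_def odds_prod_add distrib_left)

text \<open>The odds for leaving \<open>(x - a, x + b)\<close> on the left rather than on the right: the resistance
  to the right of \<open>x\<close> over the resistance to its left, both relative to the leftmost edge.\<close>

definition exit_ratio :: "(int \<Rightarrow> real \<times> real) \<Rightarrow> int \<Rightarrow> nat \<Rightarrow> nat \<Rightarrow> real" where
  "exit_ratio \<omega> x a b = odds_prod \<omega> (x - int a + 1) a * resistance \<omega> (x + 1) b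
    / resistance \<omega> (x - int a + 1) a"

definition exit_left :: "(int \<Rightarrow> real \<times> real) \<Rightarrow> int \<Rightarrow> int \<Rightarrow> int \<Rightarrow> real" where
  "exit_left \<omega> l r x = measure (quenched x \<omega>) {X. reaches_within {l<..<r} {..l} X}"

locale environment =
  fixes \<kappa> :: real and \<omega> :: "int \<Rightarrow> real \<times> real"
  assumes \<kappa>_pos: "0 < \<kappa>" and range: "range \<omega> \<subseteq> site_simplex \<kappa>"
begin

lemma \<kappa>_nonneg: "0 \<le> \<kappa>"
  using \<kappa>_pos by simp

lemma site: "fst (\<omega> x) + snd (\<omega> x) = 1" "0 < fst (\<omega> x)" "0 < snd (\<omega> x)"
  using range \<kappa>_pos by (auto simp: site_simplex_def image_subset_iff intro: less_le_trans)

lemma odds_pos: "0 < odds (\<omega> x)"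
  using site by (simp add: odds_def)

lemma odds_prod_pos: "0 < odds_prod \<omega> s k"
  by (simp add: odds_prod_def prod_pos odds_pos)

lemma resistance_ge_1: "0 < n \<Longrightarrow> 1 \<le> resistance \<omega> s n"
  unfolding resistance_def
  using member_le_sum[of 0 "{..<n}" "odds_prod \<omega> s"] odds_prod_pos[of s]
  by (simp add: less_imp_le)

lemma resistance_mono: "m \<le> n \<Longrightarrow> resistance \<omega> s m \<le> resistance \<omega> s n"
  unfolding resistance_def using odds_prod_pos by (intro sum_mono2) (auto simp: less_imp_le)

text \<open>The increments of a harmonic function are multiplied by the odds from one edge to the next,
  so the boundary values determine it.\<close>

lemma harmonic_increment:
  assumes "u x = fst (\<omega> x) * u (x + 1) + snd (\<omega> x) * u (x - 1)"
  shows "u x - u (x + 1) = odds (\<omega> x) * (u (x - 1) - u x)"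
proof -
  have "fst (\<omega> x) * (u x - u (x + 1)) = snd (\<omega> x) * (u (x - 1) - u x)"
    using assms site(1)[of x] by algebra
  then show ?thesis
    using site(2)[of x] by (simp add: odds_def field_simps)
qed

lemma harmonic_increments:
  assumes "\<And>i. i < k \<Longrightarrow> u (s + int i) =
    fst (\<omega> (s + int i)) * u (s + int i + 1) + snd (\<omega> (s + int i)) * u (s + int i - 1)"
  shows "u (s + int k - 1) - u (s + int k) = (u (s - 1) - u s) * odds_prod \<omega> s k"
  using assms
proof (induction k)
  case (Suc k)
  have "u (s + int k) - u (s + int k + 1) = odds (\<omega> (s + int k)) * ((u (s - 1) - u s) * odds_prod \<omega> s k)"
    using harmonic_increment[OF Suc.prems[of k]] Suc.IH[OF Suc.prems] by simp
  then show ?case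
    by (simp add: odds_prod_def add.assoc add.commute[of 1] mult_ac)
qed (simp add: odds_prod_def)

text \<open>The increments are known up to a common factor, and the two boundary values fix it.\<close>

lemma gamblers_ruin:
  fixes u :: "int \<Rightarrow> real"
  assumes harm: "\<And>y. x - int a < y \<Longrightarrow> y < x + int b \<Longrightarrow>
      u y = fst (\<omega> y) * u (y + 1) + snd (\<omega> y) * u (y - 1)"
    and left: "u (x - int a) = 1" and right: "u (x + int b) = 0" and ab: "0 < a" "0 < b"
  shows "u x = exit_ratio \<omega> x a b / (1 + exit_ratio \<omega> x a b)"
    and "x \<le> y \<Longrightarrow> y \<le> x + int b \<Longrightarrow> u y \<le> u x"
proof -
  define s where "s = x - int a + 1"
  define d where "d = u (s - 1) - u s"
  have inc: "u (s + int k - 1) - u (s + int k) = d * odds_prod \<omega> s k" if "k < a + b" for k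
    unfolding d_def using that
    by (intro harmonic_increments harm) (auto simp: s_def)
  have drop: "u (s - 1) - u (s + int n - 1) = d * resistance \<omega> s n" if "n \<le> a + b" for n
    using that
  proof (induction n)
    case (Suc n)
    then show ?case using inc[of n] by (simp add: resistance_def algebra_simps)
  qed (simp add: resistance_def)
  let ?L = "resistance \<omega> s a" and ?R = "odds_prod \<omega> s a * resistance \<omega> (x + 1) b"
  have total: "1 = d * (?L + ?R)"
    using drop[of "a + b"] left right by (simp add: s_def resistance_add)
  have start: "1 - u x = d * ?L"
    using drop[of a] left by (simp add: s_def)
  have pos: "0 < ?L" "0 < ?R"
    using resistance_ge_1[OF ab(1), of s] resistance_ge_1[OF ab(2), of "x + 1"] odds_prod_pos[of s a]
    by (auto intro: mult_pos_pos less_le_trans[OF zero_less_one])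
  have "u x = ?R / (?L + ?R)"
  proof -
    have "u x = d * ?R" using total start by (simp add: algebra_simps)
    moreover have "d = 1 / (?L + ?R)" using total pos by (simp add: field_simps)
    ultimately show ?thesis by simp
  qed
  also have "\<dots> = exit_ratio \<omega> x a b / (1 + exit_ratio \<omega> x a b)"
  proof -
    have "exit_ratio \<omega> x a b = ?R / ?L" by (simp add: exit_ratio_def s_def)
    moreover have "1 + ?R / ?L = (?L + ?R) / ?L" using pos by (simp add: add_divide_distrib)
    ultimately show ?thesis using pos by simp
  qed
  finally show "u x = exit_ratio \<omega> x a b / (1 + exit_ratio \<omega> x a b)" .
  have "0 < d"
    using total pos zero_less_mult_pos2[of d "?L + ?R"] by simp
  have down: "u (x + int k) \<le> u x" if "k \<le> b" for k
    using that
  proof (induction k)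
    case (Suc k)
    have "u (x + int k) - u (x + int (Suc k)) = d * odds_prod \<omega> s (Suc k + a - 1)"
      using inc[of "Suc k + a - 1"] Suc.prems by (simp add: s_def algebra_simps)
    also have "\<dots> \<ge> 0" using \<open>0 < d\<close> odds_prod_pos[of s "Suc k + a - 1"] by simp
    finally show ?case using Suc by simp
  qed simp
  show "u y \<le> u x" if "x \<le> y" "y \<le> x + int b"
    using down[of "nat (y - x)"] that by simp
qed

lemma prob_space_quenched': "prob_space (quenched x \<omega>)"
  by (rule prob_space_quenched[OF range \<kappa>_nonneg])

lemmas first_step = measure_quenched_first_step[OF range \<kappa>_nonneg]

lemma measure_quenched_UNIV: "measure (quenched x \<omega>) UNIV = 1"
  using prob_space.prob_space[OF prob_space_quenched'] space_quenched[OF range \<kappa>_nonneg] by simp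

lemma exit_left_eq:
  assumes "l < r"
  shows "x \<le> l \<Longrightarrow> exit_left \<omega> l r x = 1" "r \<le> x \<Longrightarrow> exit_left \<omega> l r x = 0"
    and "l < x \<Longrightarrow> x < r \<Longrightarrow>
      exit_left \<omega> l r x = fst (\<omega> x) * exit_left \<omega> l r (x + 1) + snd (\<omega> x) * exit_left \<omega> l r (x - 1)"
  using assms site[of x]
  by (simp_all add: exit_left_def first_step vimage_def reaches_within_case_nat measure_quenched_UNIV)

lemma exit_left_ratio:
  assumes "0 < a" "0 < b"
  shows "exit_left \<omega> (x - int a) (x + int b) x = exit_ratio \<omega> x a b / (1 + exit_ratio \<omega> x a b)"
    and "x \<le> y \<Longrightarrow> y \<le> x + int b \<Longrightarrow>
      exit_left \<omega> (x - int a) (x + int b) y \<le> exit_left \<omega> (x - int a) (x + int b) x"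
  using assms
  by (intro gamblers_ruin[where u = "exit_left \<omega> (x - int a) (x + int b)"] exit_left_eq, auto)+

text \<open>A nearest-neighbour walk leaves an interval through an end point, so of \<open>D\<close> outside the interval
  only the end points matter. The conditions below lead to sets \<open>D\<close> that also contain sites far to
  the right.\<close>

lemma reaches_within_eq_exit_left:
  assumes "l < x" "x < r" "l \<in> D" "r \<notin> D" "D \<inter> {l<..<r} = {}"
  shows "measure (quenched x \<omega>) {X. reaches_within {l<..<r} D X} = exit_left \<omega> l r x"
proof -
  define a where "a = nat (x - l)"
  define b where "b = nat (r - x)"
  have ab: "l = x - int a" "r = x + int b" "0 < a" "0 < b"
    using assms by (auto simp: a_def b_def)
  let ?u = "\<lambda>y. measure (quenched y \<omega>) {X. reaches_within {l<..<r} D X}"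
  have step: "?u y = (if y \<in> D then 1 else if y \<in> {l<..<r}
      then fst (\<omega> y) * ?u (y + 1) + snd (\<omega> y) * ?u (y - 1) else 0)" for y
  proof -
    consider "y \<in> D" | "y \<notin> D" "y \<in> {l<..<r}" | "y \<notin> D" "y \<notin> {l<..<r}" by blast
    then show ?thesis
      using site(1)[of y]
      by cases (simp_all only: first_step[OF reaches_within_in_sets, of y] vimage_Collect_eq
          reaches_within_case_nat, simp_all add: measure_quenched_UNIV)
  qed
  have "?u x = exit_ratio \<omega> x a b / (1 + exit_ratio \<omega> x a b)"
  proof (rule gamblers_ruin(1))
    show "?u y = fst (\<omega> y) * ?u (y + 1) + snd (\<omega> y) * ?u (y - 1)"
      if "x - int a < y" "y < x + int b" for y
      using that assms(5) by (subst step) (auto simp: ab)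
    show "?u (x - int a) = 1" "?u (x + int b) = 0"
      unfolding ab(1,2)[symmetric] using step[of l] step[of r] assms(3,4) by auto
  qed (use ab in auto)
  also have "\<dots> = exit_left \<omega> l r x"
    using exit_left_ratio(1)[of a b x] ab by simp
  finally show ?thesis .
qed

end

section \<open>Sums of bounded centred variables\<close>

lemma (in prob_space) integrable_bounded:
  fixes f :: "'a \<Rightarrow> real"
  assumes "f \<in> borel_measurable M" "\<And>\<omega>. \<omega> \<in> space M \<Longrightarrow> \<bar>f \<omega>\<bar> \<le> C"
  shows "integrable M f"
  using assms by (intro integrable_const_bound[of _ C]) auto

text \<open>When a summand is added, the mixed moments with a first power of one factor vanish, and the
  bound \<open>B\<close> turns the fourth moment of the new summand into a second one.\<close>

lemma (in prob_space) moments_of_centred_sum: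
  fixes X :: "'i \<Rightarrow> 'a \<Rightarrow> real"
  assumes "finite I" "indep_vars (\<lambda>_. borel) X I"
    and bounded: "\<And>i \<omega>. i \<in> I \<Longrightarrow> \<omega> \<in> space M \<Longrightarrow> \<bar>X i \<omega>\<bar> \<le> B"
    and centred: "\<And>i. i \<in> I \<Longrightarrow> expectation (X i) = 0"
  defines "S \<equiv> \<lambda>I \<omega>. \<Sum>i\<in>I. X i \<omega>" and "v \<equiv> \<lambda>I. \<Sum>i\<in>I. expectation (\<lambda>\<omega>. X i \<omega> ^ 2)"
  shows "expectation (S I) = 0" "expectation (\<lambda>\<omega>. S I \<omega> ^ 2) = v I"
    and "expectation (\<lambda>\<omega>. S I \<omega> ^ 4) \<le> 3 * v I ^ 2 + B\<^sup>2 * v I"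
proof -
  have "expectation (S J) = 0 \<and> expectation (\<lambda>\<omega>. S J \<omega> ^ 2) = v J \<and>
      expectation (\<lambda>\<omega>. S J \<omega> ^ 4) \<le> 3 * v J ^ 2 + B\<^sup>2 * v J" if "J \<subseteq> I" for J
    using finite_subset[OF that \<open>finite I\<close>] that
  proof (induction J rule: finite_induct)
    case empty
    then show ?case by (simp add: S_def v_def)
  next
    case (insert i J)
    then have i: "i \<in> I" and IH: "expectation (S J) = 0" "expectation (\<lambda>\<omega>. S J \<omega> ^ 2) = v J"
      "expectation (\<lambda>\<omega>. S J \<omega> ^ 4) \<le> 3 * v J ^ 2 + B\<^sup>2 * v J" by auto
    have S_insert: "S (insert i J) \<omega> = X i \<omega> + S J \<omega>" for \<omega>
      using insert.hyps by (simp add: S_def)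
    have v_insert: "v (insert i J) = expectation (\<lambda>\<omega>. X i \<omega> ^ 2) + v J"
      using insert.hyps by (simp add: v_def)
    have X_meas [measurable]: "X j \<in> borel_measurable M" if "j \<in> I" for j
      using assms(2) that by (simp add: indep_vars_def)
    note [measurable] = X_meas[OF i]
    have [measurable]: "S J \<in> borel_measurable M"
      unfolding S_def using insert.prems by (intro borel_measurable_sum X_meas) auto
    have indep: "indep_var borel (X i) borel (S J)"
      using indep_vars_sum[OF insert.hyps(1,2) indep_vars_subset[OF assms(2) insert.prems]]
      by (simp add: S_def[abs_def])
    have Sb: "\<bar>S J \<omega>\<bar> \<le> card J * B" if "\<omega> \<in> space M" for \<omega>
      unfolding S_def using insert.prems bounded that
      by (intro order_trans[OF sum_abs] sum_bounded_above) auto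
    have intX: "integrable M (\<lambda>\<omega>. X i \<omega> ^ k)" for k
      using power_mono[OF bounded[OF i], of _ k]
      by (intro integrable_bounded[of _ "B ^ k"]) (auto simp: power_abs)
    have intS: "integrable M (\<lambda>\<omega>. S J \<omega> ^ k)" for k
      using power_mono[OF Sb, of _ k]
      by (intro integrable_bounded[of _ "(card J * B) ^ k"]) (auto simp: power_abs)
    have indep_pow: "indep_var borel (\<lambda>\<omega>. X i \<omega> ^ k) borel (\<lambda>\<omega>. S J \<omega> ^ l)" for k l
      using indep_var_compose[OF indep, of "\<lambda>x. x ^ k" borel "\<lambda>x. x ^ l" borel] by (simp add: comp_def)
    have mixed: "expectation (\<lambda>\<omega>. X i \<omega> ^ k * S J \<omega> ^ l) =
        expectation (\<lambda>\<omega>. X i \<omega> ^ k) * expectation (\<lambda>\<omega>. S J \<omega> ^ l)"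
      and int_mixed: "integrable M (\<lambda>\<omega>. X i \<omega> ^ k * S J \<omega> ^ l)" for k l
      using indep_var_lebesgue_integral[OF indep_pow[of k l] intX intS]
        indep_var_integrable[OF indep_pow[of k l] intX intS] by auto
    let ?s = "expectation (\<lambda>\<omega>. X i \<omega> ^ 2)"
    have E1: "expectation (S (insert i J)) = 0"
      using IH(1) centred[OF i] intX[of 1] intS[of 1] by (simp add: S_insert[abs_def])
    have "expectation (\<lambda>\<omega>. S (insert i J) \<omega> ^ 2) =
        expectation (\<lambda>\<omega>. X i \<omega> ^ 2 + 2 * (X i \<omega> ^ 1 * S J \<omega> ^ 1) + S J \<omega> ^ 2)"
      by (intro Bochner_Integration.integral_cong refl) (simp add: S_insert power2_sum)
    also have "\<dots> = ?s + v J"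
      using intX[of 2] intS[of 2] int_mixed[of 1 1] mixed[of 1 1] IH centred[OF i] by simp
    finally have E2: "expectation (\<lambda>\<omega>. S (insert i J) \<omega> ^ 2) = v (insert i J)"
      by (simp add: v_insert)
    have "expectation (\<lambda>\<omega>. S (insert i J) \<omega> ^ 4) =
        expectation (\<lambda>\<omega>. X i \<omega> ^ 4 + 4 * (X i \<omega> ^ 3 * S J \<omega> ^ 1) + 6 * (X i \<omega> ^ 2 * S J \<omega> ^ 2)
          + 4 * (X i \<omega> ^ 1 * S J \<omega> ^ 3) + S J \<omega> ^ 4)"
      by (intro Bochner_Integration.integral_cong refl)
        (simp add: S_insert power2_eq_square power3_eq_cube power4_eq_xxxx algebra_simps)
    also have "\<dots> = expectation (\<lambda>\<omega>. X i \<omega> ^ 4) + 6 * (?s * v J) + expectation (\<lambda>\<omega>. S J \<omega> ^ 4)"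
      using intX[of 4] intS[of 4] int_mixed[of 1 3] int_mixed[of 2 2] int_mixed[of 3 1]
        mixed[of 1 3] mixed[of 2 2] mixed[of 3 1] IH(1,2) centred[OF i] by simp
    also have "expectation (\<lambda>\<omega>. X i \<omega> ^ 4) \<le> expectation (\<lambda>\<omega>. B\<^sup>2 * X i \<omega> ^ 2)"
    proof (rule integral_mono)
      fix \<omega> assume "\<omega> \<in> space M"
      from power_mono[OF bounded[OF i this], of 2] have "X i \<omega> ^ 2 \<le> B\<^sup>2" by simp
      from mult_right_mono[OF this, of "X i \<omega> ^ 2"] show "X i \<omega> ^ 4 \<le> B\<^sup>2 * X i \<omega> ^ 2"
        by (simp add: power2_eq_square power4_eq_xxxx mult.assoc)
    qed (use intX in auto)
    also have "expectation (\<lambda>\<omega>. B\<^sup>2 * X i \<omega> ^ 2) = B\<^sup>2 * ?s" by simp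
    also have "B\<^sup>2 * ?s + 6 * (?s * v J) + expectation (\<lambda>\<omega>. S J \<omega> ^ 4) \<le>
        3 * v (insert i J) ^ 2 + B\<^sup>2 * v (insert i J)"
    proof -
      have "3 * (?s + v J)\<^sup>2 + B\<^sup>2 * (?s + v J) =
          B\<^sup>2 * ?s + 6 * (?s * v J) + (3 * (v J)\<^sup>2 + B\<^sup>2 * v J) + 3 * ?s\<^sup>2"
        by (simp add: power2_sum algebra_simps)
      then show ?thesis
        unfolding v_insert using IH(3) zero_le_power2[of ?s] by linarith
    qed
    finally show ?case using E1 E2 by simp
  qed
  from this[OF order_refl] show "expectation (S I) = 0" "expectation (\<lambda>\<omega>. S I \<omega> ^ 2) = v I"
    "expectation (\<lambda>\<omega>. S I \<omega> ^ 4) \<le> 3 * v I ^ 2 + B\<^sup>2 * v I" by auto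
qed

text \<open>A quartic minorant of the indicator of the half-line; its quadratic term has a positive
  coefficient, so that the second moment can beat the fourth.\<close>

lemma quartic_minorant: "y / 2 + y\<^sup>2 / 2 - y ^ 4 / 4 \<le> (if 0 \<le> y then 1 else 0)" for y :: real
proof (cases "0 \<le> y")
  case True
  have "1 - (y / 2 + y\<^sup>2 / 2 - y ^ 4 / 4) = (y\<^sup>2 / 2 - 3 / 4)\<^sup>2 + (y - 1)\<^sup>2 / 4 + 3 / 16"
    by (simp add: power2_eq_square power4_eq_xxxx field_simps)
  also have "\<dots> \<ge> 0" by simp
  finally show ?thesis using True by simp
next
  case False
  define t where "t = - y"
  have t: "0 < t" using False by (simp add: t_def)
  have "t ^ 3 - 2 * t + 2 = t * (t - 1)\<^sup>2 + 2 * (t - 3 / 4)\<^sup>2 + 7 / 8"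
    by (simp add: power2_eq_square power3_eq_cube algebra_simps)
  also have "\<dots> \<ge> 0" using t by simp
  finally have "0 \<le> t * (t ^ 3 - 2 * t + 2)" using t by simp
  then show ?thesis
    using False by (simp add: t_def power2_eq_square power3_eq_cube power4_eq_xxxx algebra_simps)
qed

text \<open>A centred sum is not very likely to be below \<open>-2\<close>, uniformly in the number of terms and in
  their laws. If the variance is less than one this is Chebyshev's inequality; otherwise
  the fourth moment is at most a multiple of the squared variance, which excludes that the sum is
  slightly negative with overwhelming probability and large otherwise.\<close>

lemma (in prob_space) centred_sum_not_negative:
  fixes X :: "'i \<Rightarrow> 'a \<Rightarrow> real"
  assumes "finite I" "indep_vars (\<lambda>_. borel) X I"
    and "\<And>i \<omega>. i \<in> I \<Longrightarrow> \<omega> \<in> space M \<Longrightarrow> \<bar>X i \<omega>\<bar> \<le> B"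
    and "\<And>i. i \<in> I \<Longrightarrow> expectation (X i) = 0"
  shows "1 / (4 * (3 + B\<^sup>2)) \<le> prob {\<omega> \<in> space M. - 2 \<le> (\<Sum>i\<in>I. X i \<omega>)}"
proof -
  define S where "S = (\<lambda>\<omega>. \<Sum>i\<in>I. X i \<omega>)"
  define v where "v = (\<Sum>i\<in>I. expectation (\<lambda>\<omega>. X i \<omega> ^ 2))"
  define A where "A = 3 + B\<^sup>2"
  have m: "expectation S = 0" "expectation (\<lambda>\<omega>. S \<omega> ^ 2) = v"
    "expectation (\<lambda>\<omega>. S \<omega> ^ 4) \<le> 3 * v ^ 2 + B\<^sup>2 * v"
    unfolding S_def v_def using moments_of_centred_sum[OF assms] by simp_all
  have A: "3 \<le> A" by (simp add: A_def)
  have meas [measurable]: "S \<in> borel_measurable M"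
    unfolding S_def using assms(2) by (intro borel_measurable_sum) (simp add: indep_vars_def)
  have Sb: "\<bar>S \<omega>\<bar> \<le> card I * B" if "\<omega> \<in> space M" for \<omega>
    unfolding S_def using assms(3) that
    by (intro order_trans[OF sum_abs] sum_bounded_above) auto
  have intS: "integrable M (\<lambda>\<omega>. S \<omega> ^ k)" for k
    using power_mono[OF Sb, of _ k]
    by (intro integrable_bounded[of _ "(card I * B) ^ k"]) (auto simp: power_abs)
  note intS' = intS[of 1, simplified] intS[of 2] intS[of 4]
  let ?F = "{\<omega> \<in> space M. - 2 \<le> S \<omega>}"
  have F: "prob ?F = expectation (indicator ?F)" by simp
  have F_sets: "?F \<in> events" by measurable
  have intF: "integrable M (indicator ?F :: 'a \<Rightarrow> real)"
    using F_sets by (intro integrable_bounded[of _ 1]) (auto simp: indicator_def)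
  have "1 / (4 * A) \<le> prob ?F"
  proof (cases "1 \<le> v")
    case False
    have "1 - v / 4 = expectation (\<lambda>\<omega>. 1 - S \<omega> ^ 2 / 4)"
      using intS' m(2) by (simp add: prob_space)
    also have "\<dots> \<le> expectation (indicator ?F)"
    proof (rule integral_mono)
      fix \<omega> assume "\<omega> \<in> space M"
      have "4 \<le> S \<omega> ^ 2" if "\<not> - 2 \<le> S \<omega>"
        using power_mono[of 2 "- S \<omega>" 2] that by simp
      with \<open>\<omega> \<in> space M\<close> show "1 - S \<omega> ^ 2 / 4 \<le> indicator ?F \<omega>"
        by (auto simp: indicator_def)
    qed (use intS' intF in auto)
    finally have "1 - v / 4 \<le> prob ?F" unfolding F .
    moreover have "1 / (4 * A) \<le> 1 / 4" using A by (simp add: field_simps)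
    ultimately show ?thesis using False by simp
  next
    case True
    \<comment> \<open>at this scale the minorant gains \<open>1 / (2 * A)\<close> from the second moment and loses at most half of that
      to the fourth\<close>
    define s where "s = sqrt (A * v)"
    have s: "0 < s" "s\<^sup>2 = A * v" using A True by (auto simp: s_def)
    have s4: "s ^ 4 = (A * v)\<^sup>2"
      unfolding s(2)[symmetric] by simp
    have "B\<^sup>2 * v \<le> B\<^sup>2 * v\<^sup>2"
      using True by (intro mult_left_mono) (auto simp: power2_eq_square)
    then have fourth: "expectation (\<lambda>\<omega>. S \<omega> ^ 4) \<le> A * v\<^sup>2"
      using m(3) by (simp add: A_def algebra_simps)
    have "1 / (4 * A) = v / (2 * (A * v)) - A * v\<^sup>2 / (4 * (A * v)\<^sup>2)"
      using A True by (simp add: field_simps power2_eq_square)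
    also have "\<dots> \<le> v / (2 * s\<^sup>2) - expectation (\<lambda>\<omega>. S \<omega> ^ 4) / (4 * s ^ 4)"
      unfolding s s4 using fourth by (intro diff_left_mono divide_right_mono) auto
    also have "\<dots> = expectation (\<lambda>\<omega>. (S \<omega> / s) / 2 + (S \<omega> / s)\<^sup>2 / 2 - (S \<omega> / s) ^ 4 / 4)"
      using intS' m(1,2) by (simp add: power_divide mult.commute)
    also have "\<dots> \<le> expectation (indicator ?F)"
    proof (rule integral_mono)
      fix \<omega> assume "\<omega> \<in> space M"
      with quartic_minorant[of "S \<omega> / s"] s(1)
      show "(S \<omega> / s) / 2 + (S \<omega> / s)\<^sup>2 / 2 - (S \<omega> / s) ^ 4 / 4 \<le> indicator ?F \<omega>"
        by (auto simp: indicator_def zero_le_divide_iff split: if_splits)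
    qed (use intS' intF in \<open>auto simp: power_divide\<close>)
    finally show ?thesis unfolding F .
  qed
  then show ?thesis by (simp add: A_def S_def)
qed

section \<open>The law of the environment\<close>

locale iid_environment =
  fixes \<kappa> :: real and \<mu> :: "(real \<times> real) measure"
  assumes \<kappa>_pos: "0 < \<kappa>" and site_law: "site_law \<kappa> \<mu>"
begin

sublocale site: prob_space \<mu>
  using site_law by (simp add: site_law_def)

sublocale E: prob_space "env_law \<mu>"
  by (rule prob_space_env_law[OF site_law])

lemma environment: "\<omega> \<in> space (env_law \<mu>) \<Longrightarrow> environment \<kappa> \<omega>"
  using space_env_law[OF site_law] \<kappa>_pos by (simp add: environment_def)

lemma odds_measurable [measurable]: "odds \<in> borel_measurable \<mu>"
proof -
  have id: "(\<lambda>z. z) \<in> measurable \<mu> borel"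
    using site_law by (simp add: site_law_def measurable_restrict_space1 cong: measurable_cong_sets)
  have "fst \<in> borel_measurable (borel :: (real \<times> real) measure)"
    "snd \<in> borel_measurable (borel :: (real \<times> real) measure)"
    by (simp_all add: borel_measurable_continuous_onI continuous_intros)
  from this[THEN measurable_compose[OF id]] show ?thesis
    unfolding odds_def[abs_def] by (intro borel_measurable_divide)
qed

lemma coordinate_measurable [measurable]: "(\<lambda>\<omega>. \<omega> i) \<in> measurable (env_law \<mu>) \<mu>"
  unfolding env_law_def by (rule measurable_component_singleton) simp

lemma odds_prod_measurable [measurable]: "(\<lambda>\<omega>. odds_prod \<omega> s k) \<in> borel_measurable (env_law \<mu>)"
  unfolding odds_prod_def by measurable

lemma resistance_measurable [measurable]: "(\<lambda>\<omega>. resistance \<omega> s n) \<in> borel_measurable (env_law \<mu>)"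
  unfolding resistance_def by measurable

lemma exit_ratio_measurable [measurable]: "(\<lambda>\<omega>. exit_ratio \<omega> x a b) \<in> borel_measurable (env_law \<mu>)"
  unfolding exit_ratio_def by measurable

lemma distr_reindex:
  fixes f :: "'i \<Rightarrow> int"
  assumes "inj f"
  shows "distr (env_law \<mu>) (PiM UNIV (\<lambda>_. \<mu>)) (\<lambda>\<omega> i. \<omega> (f i)) = PiM UNIV (\<lambda>_. \<mu>)"
  using distr_PiM_reindex[of UNIV "\<lambda>_. \<mu>" f UNIV] assms site.prob_space_axioms
  by (simp add: env_law_def restrict_def)

lemma distr_coordinate: "distr (env_law \<mu>) \<mu> (\<lambda>\<omega>. \<omega> i) = \<mu>"
  unfolding env_law_def by (rule distr_PiM_component) (auto intro: site.prob_space_axioms)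

lemma expectation_coordinate:
  fixes g :: "real \<times> real \<Rightarrow> real"
  assumes "g \<in> borel_measurable \<mu>"
  shows "(\<integral>\<omega>. g (\<omega> i) \<partial>env_law \<mu>) = (\<integral>z. g z \<partial>\<mu>)"
  using integral_distr[OF coordinate_measurable assms, of i] by (simp add: distr_coordinate)

lemma indep_coordinates:
  fixes f :: "'i \<Rightarrow> int"
  assumes "inj f"
  shows "E.indep_vars (\<lambda>_. \<mu>) (\<lambda>i \<omega>. \<omega> (f i)) UNIV"
  using distr_reindex[OF assms]
  by (subst E.indep_vars_iff_distr_eq_PiM) (auto simp: distr_coordinate restrict_def)

lemma indep_site_functions:
  fixes g :: "real \<times> real \<Rightarrow> real"
  assumes "g \<in> borel_measurable \<mu>"
  shows "E.indep_vars (\<lambda>_. borel) (\<lambda>i \<omega>. g (\<omega> (s + int i))) I"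
proof -
  have "E.indep_vars (\<lambda>_. borel) (\<lambda>i \<omega>. g (\<omega> (s + int i))) UNIV"
    using assms by (intro E.indep_vars_compose2[OF indep_coordinates]) (auto intro: injI)
  then show ?thesis by (rule E.indep_vars_subset) simp
qed

definition drift :: real where
  "drift = (\<integral>z. ln (odds z) \<partial>\<mu>)"

lemma ln_odds_bound: "z \<in> space \<mu> \<Longrightarrow> 0 < odds z \<and> \<bar>ln (odds z)\<bar> \<le> - ln \<kappa>"
proof -
  assume "z \<in> space \<mu>"
  then have z: "fst z + snd z = 1" "\<kappa> \<le> fst z" "\<kappa> \<le> snd z"
    using space_site_law[OF site_law] by (auto simp: site_simplex_def)
  then have pos: "0 < fst z" "0 < snd z" using \<kappa>_pos by auto
  have "ln \<kappa> \<le> ln (fst z)" "ln \<kappa> \<le> ln (snd z)" "ln (fst z) \<le> 0" "ln (snd z) \<le> 0"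
    using z pos \<kappa>_pos by auto
  moreover have "ln (odds z) = ln (snd z) - ln (fst z)" "0 < odds z"
    using pos by (simp_all add: odds_def ln_div)
  ultimately show ?thesis unfolding abs_le_iff by linarith
qed

lemma integrable_ln_odds: "integrable \<mu> (\<lambda>z. ln (odds z))"
  using ln_odds_bound by (intro site.integrable_bounded[of _ "- ln \<kappa>"]) auto

lemma odds_space: "\<omega> \<in> space (env_law \<mu>) \<Longrightarrow> \<omega> i \<in> space \<mu>"
  by (auto simp: env_law_def space_PiM)

lemma ln_odds_prod:
  assumes "\<omega> \<in> space (env_law \<mu>)"
  shows "ln (odds_prod \<omega> s k) = (\<Sum>i<k. ln (odds (\<omega> (s + int i))))"
  unfolding odds_prod_def
  using less_imp_neq[OF environment.odds_pos[OF environment[OF assms]], THEN not_sym]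
  by (intro ln_prod) simp_all

end

section \<open>Nonnegative drift: exits to the left keep a positive probability\<close>

text \<open>The constant of \<open>centred_sum_not_negative\<close> for centred logarithms of odds, which are bounded
  by \<open>- 2 ln \<kappa>\<close>.\<close>

definition rise_bound :: "real \<Rightarrow> real" where
  "rise_bound \<kappa> = 1 / (4 * (3 + (2 * ln \<kappa>)\<^sup>2))"

text \<open>The constant \<open>\<lambda>\<^sub>1\<close>. If the drift is nonnegative, the exit ratio of a symmetric box is at least
  \<open>exp (- 2)\<close> with probability at least \<open>rise_bound\<^sup>2 / 2\<close>, and then a left exit has quenched
  probability at least \<open>1 / (1 + exp 2)\<close>.\<close>

definition exit_bound :: "real \<Rightarrow> real" where
  "exit_bound \<kappa> = (rise_bound \<kappa>)\<^sup>2 / 2 / (1 + exp 2)"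

lemma exit_bound_pos: "0 < exit_bound \<kappa>" and exit_bound_less_1: "exit_bound \<kappa> < 1"
proof -
  have b: "0 < rise_bound \<kappa>" "rise_bound \<kappa> \<le> 1"
    by (auto simp: rise_bound_def add_pos_nonneg field_simps)
  then show "0 < exit_bound \<kappa>"
    by (simp add: exit_bound_def add_pos_pos)
  have "(rise_bound \<kappa>)\<^sup>2 / 2 < 1 + exp 2"
    using b power_le_one[of "rise_bound \<kappa>" 2] exp_gt_zero[of "2::real"] by linarith
  then show "exit_bound \<kappa> < 1"
    by (simp add: exit_bound_def add_pos_pos)
qed

context iid_environment
begin

text \<open>Subtracting the drift only lowers the sum and makes it centred.\<close>

lemma potential_not_negative:
  assumes "0 \<le> drift"
  shows "rise_bound \<kappa> \<le> E.prob {\<omega> \<in> space (env_law \<mu>). - 2 \<le> ln (odds_prod \<omega> s k)}"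
proof -
  define X where "X = (\<lambda>i \<omega>. ln (odds (\<omega> (s + int i))) - drift)"
  have int: "integrable (env_law \<mu>) (\<lambda>\<omega>. ln (odds (\<omega> i)))" for i
    using ln_odds_bound[OF odds_space] by (intro E.integrable_bounded[of _ "- ln \<kappa>"]) auto
  have "\<bar>drift\<bar> \<le> (\<integral>z. \<bar>ln (odds z)\<bar> \<partial>\<mu>)"
    unfolding drift_def by (rule integral_abs_bound)
  also have "\<dots> \<le> (\<integral>z. - ln \<kappa> \<partial>\<mu>)"
    using ln_odds_bound integrable_ln_odds by (intro integral_mono) auto
  finally have drift: "\<bar>drift\<bar> \<le> - ln \<kappa>" by (simp add: site.prob_space)
  have "1 / (4 * (3 + (- (2 * ln \<kappa>))\<^sup>2)) \<le> E.prob {\<omega> \<in> space (env_law \<mu>). - 2 \<le> (\<Sum>i<k. X i \<omega>)}"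
  proof (rule E.centred_sum_not_negative)
    show "E.indep_vars (\<lambda>_. borel) X {..<k}"
      unfolding X_def using indep_site_functions[of "\<lambda>z. ln (odds z) - drift"] by simp
    show "E.expectation (X i) = 0" for i
      using int expectation_coordinate[of "\<lambda>z. ln (odds z)"]
      by (simp add: X_def drift_def E.prob_space)
    show "\<bar>X i \<omega>\<bar> \<le> - (2 * ln \<kappa>)" if "\<omega> \<in> space (env_law \<mu>)" for i \<omega>
      using drift ln_odds_bound[OF odds_space[OF that], of "s + int i"] unfolding X_def by linarith
  qed simp
  also have "\<dots> \<le> E.prob {\<omega> \<in> space (env_law \<mu>). - 2 \<le> ln (odds_prod \<omega> s k)}"
  proof (rule E.finite_measure_mono)
    have "(\<Sum>i<k. X i \<omega>) \<le> (\<Sum>i<k. ln (odds (\<omega> (s + int i))))" for \<omega>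
      unfolding X_def using assms by (intro sum_mono) simp
    then show "{\<omega> \<in> space (env_law \<mu>). - 2 \<le> (\<Sum>i<k. X i \<omega>)}
        \<subseteq> {\<omega> \<in> space (env_law \<mu>). - 2 \<le> ln (odds_prod \<omega> s k)}"
      by (auto simp: ln_odds_prod intro: order_trans)
  qed measurable
  finally show ?thesis by (simp add: rise_bound_def)
qed

lemma indep_blocks:
  "E.indep_var borel (\<lambda>\<omega>. odds_prod \<omega> s k) borel (\<lambda>\<omega>. odds_prod \<omega> (s + int k) l)"
proof -
  let ?A = "{s..<s + int k}" and ?B = "{s + int k..<s + int k + int l}"
  have coord: "E.indep_vars (\<lambda>_. \<mu>) (\<lambda>i \<omega>. \<omega> i) (UNIV :: int set)"
    using indep_coordinates[of id] by simp
  have meas: "(\<lambda>h. odds_prod h t m) \<in> borel_measurable (PiM {t..<t + int m} (\<lambda>_. \<mu>))" for t m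
  proof -
    have "(\<lambda>h. h (t + int i)) \<in> measurable (PiM {t..<t + int m} (\<lambda>_. \<mu>)) \<mu>" if "i < m" for i
      using that by (intro measurable_component_singleton) simp
    from measurable_compose[OF this odds_measurable] show ?thesis
      unfolding odds_prod_def by (intro borel_measurable_prod) simp
  qed
  have "E.indep_var borel ((\<lambda>h. odds_prod h s k) \<circ> (\<lambda>\<omega>. restrict (\<lambda>i. \<omega> i) ?A))
      borel ((\<lambda>h. odds_prod h (s + int k) l) \<circ> (\<lambda>\<omega>. restrict (\<lambda>i. \<omega> i) ?B))"
    using meas by (intro E.indep_var_compose[OF E.indep_var_restrict[OF coord]]) auto
  moreover have "odds_prod (restrict \<omega> {t..<t + int m}) t m = odds_prod \<omega> t m" for \<omega> t m
    by (simp add: odds_prod_def)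
  ultimately show ?thesis by (simp add: comp_def)
qed

text \<open>The exit ratio of a symmetric box is the exponential of the potential increment over the left
  half, times the quotient of the resistances of the right and the left half, each relative to its
  own first edge. The two halves are exchangeable; so, among the environments whose potential
  increments over both halves are at least \<open>-2\<close>, the quotient is at least one with
  conditional probability at least \<open>1 / 2\<close>.\<close>

lemma exit_ratio_not_small:
  assumes "0 \<le> drift" "0 < n"
  shows "(rise_bound \<kappa>)\<^sup>2 / 2 \<le> E.prob {\<omega> \<in> space (env_law \<mu>). exp (- 2) \<le> exit_ratio \<omega> 0 n n}"
proof -
  define s where "s = 1 - int n"
  let ?\<Omega> = "space (env_law \<mu>)"
  let ?up = "\<lambda>\<omega> t. - 2 \<le> ln (odds_prod \<omega> t n)"
  \<comment> \<open>the blocks \<open>{1 - n..0}\<close> and \<open>{1..n}\<close> trade places\<close>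
  define swap where "swap i = (if s \<le> i \<and> i \<le> 0 then i + int n
    else if 1 \<le> i \<and> i \<le> int n then i - int n else i)" for i
  define T where "T \<omega> = (\<lambda>i. \<omega> (swap i))" for \<omega> :: "int \<Rightarrow> real \<times> real"
  have "inj swap"
    by (rule injI) (auto simp: swap_def s_def split: if_splits)
  then have distr_T: "distr (env_law \<mu>) (env_law \<mu>) T = env_law \<mu>"
    using distr_reindex[of swap] unfolding T_def[abs_def] by (simp add: env_law_def)
  have T_meas [measurable]: "T \<in> measurable (env_law \<mu>) (env_law \<mu>)"
  proof -
    have "T \<in> measurable (env_law \<mu>) (PiM UNIV (\<lambda>_. \<mu>))"
      by (rule measurable_PiM_single') (auto simp: T_def env_law_def space_PiM)
    then show ?thesis by (simp add: env_law_def)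
  qed
  have T_prod: "odds_prod (T \<omega>) s k = odds_prod \<omega> 1 k" "odds_prod (T \<omega>) 1 k = odds_prod \<omega> s k"
    if "k \<le> n" for \<omega> k
    unfolding odds_prod_def using that
    by (auto intro!: prod.cong arg_cong[where f = "\<lambda>i. odds (\<omega> i)"] simp: T_def swap_def s_def)
  have T_res: "resistance (T \<omega>) s n = resistance \<omega> 1 n" "resistance (T \<omega>) 1 n = resistance \<omega> s n" for \<omega>
    unfolding resistance_def by (auto intro!: sum.cong T_prod)
  define F where "F = {\<omega> \<in> ?\<Omega>. ?up \<omega> s \<and> ?up \<omega> 1 \<and> resistance \<omega> s n \<le> resistance \<omega> 1 n}"
  define F' where "F' = {\<omega> \<in> ?\<Omega>. ?up \<omega> s \<and> ?up \<omega> 1 \<and> resistance \<omega> 1 n \<le> resistance \<omega> s n}"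
  have [measurable]: "Measurable.pred (env_law \<mu>) (\<lambda>\<omega>. resistance \<omega> t n \<le> resistance \<omega> t' n)" for t t'
    unfolding pred_def by (intro borel_measurable_le resistance_measurable)
  have [measurable]: "F \<in> E.events" unfolding F_def by measurable
  have [measurable]: "F' \<in> E.events" unfolding F'_def by measurable
  have "T -` F \<inter> ?\<Omega> = F'"
    using measurable_space[OF T_meas] by (auto simp: F_def F'_def T_prod T_res)
  then have swap_prob: "E.prob F' = E.prob F"
    using measure_distr[OF T_meas, of F] by (simp add: distr_T)
  have "E.prob {\<omega> \<in> ?\<Omega>. ?up \<omega> s \<and> ?up \<omega> 1} = E.prob {\<omega> \<in> ?\<Omega>. ?up \<omega> s} * E.prob {\<omega> \<in> ?\<Omega>. ?up \<omega> 1}"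
  proof -
    have "E.indep_var borel (\<lambda>\<omega>. odds_prod \<omega> s n) borel (\<lambda>\<omega>. odds_prod \<omega> 1 n)"
      using indep_blocks[of s n n] by (simp add: s_def)
    from E.indep_varD[OF this, of "{y. - 2 \<le> ln y}" "{y. - 2 \<le> ln y}"]
    show ?thesis by (simp add: vimage_def Int_def conj_commute)
  qed
  moreover have "rise_bound \<kappa> * rise_bound \<kappa> \<le> E.prob {\<omega> \<in> ?\<Omega>. ?up \<omega> s} * E.prob {\<omega> \<in> ?\<Omega>. ?up \<omega> 1}"
    using potential_not_negative[OF assms(1)] by (intro mult_mono) (auto simp: rise_bound_def)
  moreover have "E.prob {\<omega> \<in> ?\<Omega>. ?up \<omega> s \<and> ?up \<omega> 1} \<le> E.prob (F \<union> F')"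
    by (rule E.finite_measure_mono) (auto simp: F_def F'_def)
  moreover have "E.prob (F \<union> F') \<le> E.prob F + E.prob F'"
    by (rule measure_Un_le) auto
  ultimately have "(rise_bound \<kappa>)\<^sup>2 / 2 \<le> E.prob F"
    using swap_prob by (simp add: power2_eq_square)
  also have "\<dots> \<le> E.prob {\<omega> \<in> ?\<Omega>. exp (- 2) \<le> exit_ratio \<omega> 0 n n}"
  proof (rule E.finite_measure_mono)
    show "F \<subseteq> {\<omega> \<in> ?\<Omega>. exp (- 2) \<le> exit_ratio \<omega> 0 n n}"
    proof
      fix \<omega> assume "\<omega> \<in> F"
      then have \<omega>: "\<omega> \<in> ?\<Omega>" "?up \<omega> s" "resistance \<omega> s n \<le> resistance \<omega> 1 n" by (auto simp: F_def)
      interpret environment \<kappa> \<omega> by (rule environment[OF \<omega>(1)])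
      have "exp (- 2) \<le> odds_prod \<omega> s n"
        using \<omega>(2) odds_prod_pos[of s n] by (metis exp_le_cancel_iff exp_ln)
      also have "\<dots> \<le> odds_prod \<omega> s n * (resistance \<omega> 1 n / resistance \<omega> s n)"
        using \<omega>(3) odds_prod_pos[of s n] resistance_ge_1[OF assms(2), of s]
        by (simp add: le_divide_eq)
      finally show "\<omega> \<in> {\<omega> \<in> ?\<Omega>. exp (- 2) \<le> exit_ratio \<omega> 0 n n}"
        using \<omega>(1) by (simp add: exit_ratio_def s_def)
    qed
  qed measurable
  finally show ?thesis .
qed

lemma exit_left_measurable [measurable]:
  assumes "0 < a" "0 < b"
  shows "(\<lambda>\<omega>. exit_left \<omega> (x - int a) (x + int b) x) \<in> borel_measurable (env_law \<mu>)"
proof (subst measurable_cong)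
  show "exit_left \<omega> (x - int a) (x + int b) x = exit_ratio \<omega> x a b / (1 + exit_ratio \<omega> x a b)"
    if "\<omega> \<in> space (env_law \<mu>)" for \<omega>
    using environment.exit_left_ratio(1)[OF environment[OF that] assms] .
qed measurable

lemma exit_left_bounds:
  assumes "\<omega> \<in> space (env_law \<mu>)"
  shows "0 \<le> exit_left \<omega> l r x" "exit_left \<omega> l r x \<le> 1"
  using prob_space.prob_le_1[OF environment.prob_space_quenched'[OF environment[OF assms]]]
  by (simp_all add: exit_left_def)

lemma integrable_exit_left:
  "0 < a \<Longrightarrow> 0 < b \<Longrightarrow> integrable (env_law \<mu>) (\<lambda>\<omega>. exit_left \<omega> (x - int a) (x + int b) x)"
  using exit_left_bounds by (intro E.integrable_bounded[of _ 1]) auto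

text \<open>Moving the right end point of a symmetric box further away only helps a left exit.\<close>

lemma exit_left_not_small:
  assumes "0 \<le> drift" "0 < n" "n \<le> b"
  shows "exit_bound \<kappa> \<le> (\<integral>\<omega>. exit_left \<omega> (- int n) (int b) 0 \<partial>env_law \<mu>)"
proof -
  let ?F = "{\<omega> \<in> space (env_law \<mu>). exp (- 2) \<le> exit_ratio \<omega> 0 n n}"
  have [measurable]: "?F \<in> E.events" by measurable
  have "exit_bound \<kappa> \<le> E.prob ?F / (1 + exp 2)"
    unfolding exit_bound_def using exit_ratio_not_small[OF assms(1,2)]
    by (intro divide_right_mono) (auto intro: add_nonneg_nonneg)
  also have "\<dots> = (\<integral>\<omega>. indicator ?F \<omega> / (1 + exp 2) \<partial>env_law \<mu>)" by simp
  also have "\<dots> \<le> (\<integral>\<omega>. exit_left \<omega> (- int n) (int b) 0 \<partial>env_law \<mu>)"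
  proof (rule integral_mono)
    show "integrable (env_law \<mu>) (\<lambda>\<omega>. exit_left \<omega> (- int n) (int b) 0)"
      using integrable_exit_left[of n b 0] assms by simp
    show "integrable (env_law \<mu>) (\<lambda>\<omega>. indicator ?F \<omega> / (1 + exp 2 :: real))"
      by (intro E.integrable_bounded[of _ 1]) (auto simp: indicator_def add_pos_pos)
    fix \<omega> assume \<omega>: "\<omega> \<in> space (env_law \<mu>)"
    interpret environment \<kappa> \<omega> by (rule environment[OF \<omega>])
    show "indicator ?F \<omega> / (1 + exp 2) \<le> exit_left \<omega> (- int n) (int b) 0"
    proof (cases "\<omega> \<in> ?F")
      case True
      let ?R = "exit_ratio \<omega> 0 n b"
      have "exp (- 2) \<le> exit_ratio \<omega> 0 n n" using True by simp
      also have "\<dots> \<le> ?R"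
        unfolding exit_ratio_def
        using odds_prod_pos[of "0 - int n + 1" n] resistance_ge_1[OF assms(2), of "0 - int n + 1"]
        by (intro divide_right_mono mult_left_mono resistance_mono assms(3)) auto
      finally have R: "exp (- 2) \<le> ?R" .
      then have "1 \<le> exp 2 * ?R"
        using mult_left_mono[OF R, of "exp 2"] by (simp flip: exp_add)
      moreover have "0 < ?R" using R exp_gt_zero[of "- 2 :: real"] by linarith
      ultimately have "1 / (1 + exp 2) \<le> ?R / (1 + ?R)"
        by (simp add: divide_simps add_pos_pos) (simp add: algebra_simps)
      then show ?thesis
        using True exit_left_ratio(1)[of n b 0] assms by simp
    next
      case False
      then show ?thesis using exit_left_bounds[OF \<omega>] by simp
    qed
  qed
  finally show ?thesis .
qed

section \<open>Negative drift: exponential decay\<close>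

text \<open>A small power \<open>\<alpha>\<close> of the odds has mean less than one, since \<open>E (exp (\<alpha> Y)) = 1 + \<alpha> E Y + O(\<alpha>\<^sup>2)\<close>
  for bounded \<open>Y\<close>.\<close>

lemma contracting_power:
  assumes "drift < 0"
  obtains \<alpha> where "0 < \<alpha>" "\<alpha> \<le> 1" "(\<integral>z. odds z powr \<alpha> \<partial>\<mu>) < 1" "0 < (\<integral>z. odds z powr \<alpha> \<partial>\<mu>)"
    "integrable \<mu> (\<lambda>z. odds z powr \<alpha>)"
proof -
  define K where "K = 1 + \<bar>ln \<kappa>\<bar>"
  have K: "1 \<le> K" "\<And>z. z \<in> space \<mu> \<Longrightarrow> \<bar>ln (odds z)\<bar> \<le> K"
    using ln_odds_bound unfolding K_def by force+
  \<comment> \<open>the first bound keeps the exponents in \<open>[- 1, 1]\<close>; by the second, the quadratic term is at most half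
    of the linear one\<close>
  define \<alpha> where "\<alpha> = min (1 / K) (- drift / (2 * K\<^sup>2))"
  have \<alpha>: "0 < \<alpha>" "\<alpha> \<le> 1 / K" "\<alpha> \<le> - drift / (2 * K\<^sup>2)" "\<alpha> \<le> 1"
  proof -
    show "0 < \<alpha>" using K assms by (auto simp: \<alpha>_def intro!: divide_neg_pos)
    show "\<alpha> \<le> 1 / K" "\<alpha> \<le> - drift / (2 * K\<^sup>2)" by (simp_all add: \<alpha>_def)
    moreover have "1 / K \<le> 1" using K by simp
    ultimately show "\<alpha> \<le> 1" by linarith
  qed
  have quadratic: "exp y \<le> 1 + y + y\<^sup>2" if "\<bar>y\<bar> \<le> 1" for y :: real
  proof (cases "0 \<le> y")
    case False
    have "exp y * (1 - y) \<le> exp y * exp (- y)"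
      using exp_ge_add_one_self[of "- y"] by (intro mult_left_mono) auto
    also have "\<dots> \<le> 1 - y * y\<^sup>2" using False by (simp flip: exp_add) (simp add: mult_le_0_iff)
    also have "\<dots> = (1 + y + y\<^sup>2) * (1 - y)" by (simp add: algebra_simps power2_eq_square)
    finally show ?thesis using False by simp
  qed (use exp_bound[of y] that in simp)
  have powr: "odds z powr \<alpha> \<le> 1 + \<alpha> * ln (odds z) + \<alpha>\<^sup>2 * K\<^sup>2" "\<bar>odds z powr \<alpha>\<bar> \<le> exp 1"
    if "z \<in> space \<mu>" for z
  proof -
    have "\<bar>\<alpha> * ln (odds z)\<bar> \<le> 1 / K * K"
      unfolding abs_mult using \<alpha> K(2)[OF that] by (intro mult_mono) auto
    then have 1: "\<bar>\<alpha> * ln (odds z)\<bar> \<le> 1" using K(1) by simp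
    have "(ln (odds z))\<^sup>2 \<le> K\<^sup>2"
      using power_mono[OF K(2)[OF that], of 2] by simp
    then have "(\<alpha> * ln (odds z))\<^sup>2 \<le> \<alpha>\<^sup>2 * K\<^sup>2"
      by (simp add: power_mult_distrib mult_left_mono)
    moreover have "odds z powr \<alpha> = exp (\<alpha> * ln (odds z))"
      using ln_odds_bound[OF that] by (simp add: powr_def)
    ultimately show "odds z powr \<alpha> \<le> 1 + \<alpha> * ln (odds z) + \<alpha>\<^sup>2 * K\<^sup>2" "\<bar>odds z powr \<alpha>\<bar> \<le> exp 1"
      using quadratic[OF 1] 1 by auto
  qed
  have int: "integrable \<mu> (\<lambda>z. odds z powr \<alpha>)"
    using powr(2) by (intro site.integrable_bounded[of _ "exp 1"]) auto
  have "(\<integral>z. odds z powr \<alpha> \<partial>\<mu>) \<le> (\<integral>z. 1 + \<alpha> * ln (odds z) + \<alpha>\<^sup>2 * K\<^sup>2 \<partial>\<mu>)"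
    using int powr(1) integrable_ln_odds by (intro integral_mono) auto
  also have "\<dots> = 1 + \<alpha> * (drift + \<alpha> * K\<^sup>2)"
    using integrable_ln_odds by (simp add: drift_def site.prob_space power2_eq_square algebra_simps)
  also have "\<dots> < 1"
  proof -
    have "\<alpha> * K\<^sup>2 \<le> - drift / 2"
      using mult_right_mono[OF \<alpha>(3), of "K\<^sup>2"] K(1) by simp
    then show ?thesis using \<alpha>(1) assms by (simp add: mult_less_0_iff)
  qed
  finally have less: "(\<integral>z. odds z powr \<alpha> \<partial>\<mu>) < 1" .
  have "0 < exp (- (\<alpha> * K))" by simp
  also have "\<dots> = (\<integral>z. exp (- (\<alpha> * K)) \<partial>\<mu>)" by (simp add: site.prob_space)
  also have "\<dots> \<le> (\<integral>z. odds z powr \<alpha> \<partial>\<mu>)"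
  proof (rule integral_mono)
    fix z assume z: "z \<in> space \<mu>"
    have "\<alpha> * - K \<le> \<alpha> * ln (odds z)"
      using \<alpha>(1) K(2)[OF z] by (intro mult_left_mono) auto
    then show "exp (- (\<alpha> * K)) \<le> odds z powr \<alpha>"
      using ln_odds_bound[OF z] by (simp add: powr_def)
  qed (use int in auto)
  finally show thesis using that \<alpha> less int by blast
qed

lemma integrable_truncated_odds_prod: "integrable (env_law \<mu>) (\<lambda>\<omega>. min 1 (odds_prod \<omega> s k))"
proof (rule E.integrable_bounded[of _ 1])
  show "\<bar>min 1 (odds_prod \<omega> s k)\<bar> \<le> 1" if "\<omega> \<in> space (env_law \<mu>)" for \<omega>
    using environment.odds_prod_pos[OF environment[OF that], of s k] by simp
qed measurable

text \<open>Since \<open>min 1 y \<le> y powr \<alpha>\<close>, independence gives a geometric bound with \<open>r = E (odds powr \<alpha>)\<close>.\<close>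

lemma truncated_odds_prod_decay:
  assumes "drift < 0"
  obtains r where "0 < r" "r < 1"
    "\<And>s k. (\<integral>\<omega>. min 1 (odds_prod \<omega> s k) \<partial>env_law \<mu>) \<le> r ^ k"
proof -
  obtain \<alpha> where \<alpha>: "0 < \<alpha>" "\<alpha> \<le> 1" and r: "(\<integral>z. odds z powr \<alpha> \<partial>\<mu>) < 1" "0 < (\<integral>z. odds z powr \<alpha> \<partial>\<mu>)"
    and int: "integrable \<mu> (\<lambda>z. odds z powr \<alpha>)"
    using contracting_power[OF assms] .
  have "(\<integral>\<omega>. min 1 (odds_prod \<omega> s k) \<partial>env_law \<mu>) \<le> (\<integral>z. odds z powr \<alpha> \<partial>\<mu>) ^ k" for s k
  proof -
    have meas: "(\<lambda>z. odds z powr \<alpha>) \<in> borel_measurable \<mu>" by measurable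
    have indep: "E.indep_vars (\<lambda>_. borel) (\<lambda>i \<omega>. odds (\<omega> (s + int i)) powr \<alpha>) {..<k}"
      using indep_site_functions[OF meas] .
    have int': "integrable (env_law \<mu>) (\<lambda>\<omega>. odds (\<omega> i) powr \<alpha>)" for i
      by (rule integrable_distr[OF coordinate_measurable]) (simp add: distr_coordinate int)
    have "(\<integral>\<omega>. min 1 (odds_prod \<omega> s k) \<partial>env_law \<mu>)
        \<le> (\<integral>\<omega>. (\<Prod>i<k. odds (\<omega> (s + int i)) powr \<alpha>) \<partial>env_law \<mu>)"
    proof (rule integral_mono)
      show "integrable (env_law \<mu>) (\<lambda>\<omega>. \<Prod>i<k. odds (\<omega> (s + int i)) powr \<alpha>)"
        by (rule E.indep_vars_integrable[OF _ indep int']) simp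
      fix \<omega> assume \<omega>: "\<omega> \<in> space (env_law \<mu>)"
      interpret environment \<kappa> \<omega> by (rule environment[OF \<omega>])
      have min_powr: "min 1 y \<le> y powr \<alpha>" if "0 < y" for y :: real
      proof (cases "1 \<le> y")
        case True
        then show ?thesis using \<alpha> ge_one_powr_ge_zero[of y \<alpha>] by simp
      next
        case False
        then show ?thesis using powr_mono'[of \<alpha> 1 y] \<alpha> that by simp
      qed
      have "min 1 (odds_prod \<omega> s k) \<le> odds_prod \<omega> s k powr \<alpha>"
        by (rule min_powr[OF odds_prod_pos])
      then show "min 1 (odds_prod \<omega> s k) \<le> (\<Prod>i<k. odds (\<omega> (s + int i)) powr \<alpha>)"
        using odds_pos by (simp add: odds_prod_def prod_powr_distrib less_imp_le)
    qed (rule integrable_truncated_odds_prod)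
    also have "\<dots> = (\<Prod>i<k. \<integral>\<omega>. odds (\<omega> (s + int i)) powr \<alpha> \<partial>env_law \<mu>)"
      by (rule E.indep_vars_lebesgue_integral[OF _ indep int']) simp
    also have "\<dots> = (\<integral>z. odds z powr \<alpha> \<partial>\<mu>) ^ k"
      using expectation_coordinate[OF meas] by simp
    finally show ?thesis .
  qed
  then show thesis using that r by blast
qed

text \<open>The probability of a left exit is at most the exit ratio, hence a sum of odds products over
  at least \<open>a\<close> sites each; the truncation at one is subadditive.\<close>

lemma exit_left_decay:
  assumes r: "0 < r" "r < 1"
    and decay: "\<And>s k. (\<integral>\<omega>. min 1 (odds_prod \<omega> s k) \<partial>env_law \<mu>) \<le> r ^ k"
    and ab: "0 < a" "0 < b"
  shows "(\<integral>\<omega>. exit_left \<omega> (x - int a) (x + int b) x \<partial>env_law \<mu>) \<le> r ^ a / (1 - r)"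
proof -
  define s where "s = x - int a + 1"
  note int = integrable_truncated_odds_prod[of s]
  have "(\<integral>\<omega>. exit_left \<omega> (x - int a) (x + int b) x \<partial>env_law \<mu>)
      \<le> (\<integral>\<omega>. (\<Sum>k<b. min 1 (odds_prod \<omega> s (a + k))) \<partial>env_law \<mu>)"
  proof (rule integral_mono)
    fix \<omega> assume \<omega>: "\<omega> \<in> space (env_law \<mu>)"
    interpret environment \<kappa> \<omega> by (rule environment[OF \<omega>])
    let ?R = "exit_ratio \<omega> x a b" and ?S = "\<Sum>k<b. odds_prod \<omega> s (a + k)"
    have S: "?S = odds_prod \<omega> s a * resistance \<omega> (x + 1) b"
      by (simp add: odds_prod_add resistance_def sum_distrib_left s_def)
    have S_pos: "0 < ?S"
      unfolding S using odds_prod_pos resistance_ge_1[OF ab(2), of "x + 1"] by simp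
    have R: "?R = ?S / resistance \<omega> s a"
      unfolding S by (simp add: exit_ratio_def s_def)
    have "?R \<le> ?S" and R_nonneg: "0 \<le> ?R"
      unfolding R using S_pos resistance_ge_1[OF ab(1), of s]
      by (auto simp: divide_le_eq mult_le_cancel_left1)
    moreover have "exit_left \<omega> (x - int a) (x + int b) x \<le> ?R"
      unfolding exit_left_ratio(1)[OF ab] using R_nonneg by (simp add: divide_le_eq mult_le_cancel_left1)
    ultimately have "exit_left \<omega> (x - int a) (x + int b) x \<le> min 1 ?S"
      using exit_left_bounds(2)[OF \<omega>, of "x - int a" "x + int b" x] by simp
    also have "min 1 (\<Sum>k\<in>K. odds_prod \<omega> s (a + k)) \<le> (\<Sum>k\<in>K. min 1 (odds_prod \<omega> s (a + k)))"
      if "finite K" for K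
      using that
    proof induction
      case (insert k K)
      have "min 1 (p + q) \<le> min 1 p + min 1 q" if "0 \<le> p" "0 \<le> q" for p q :: real
        using that by (auto simp: min_def)
      then have "min 1 (\<Sum>k\<in>insert k K. odds_prod \<omega> s (a + k)) \<le>
          min 1 (odds_prod \<omega> s (a + k)) + min 1 (\<Sum>k\<in>K. odds_prod \<omega> s (a + k))"
        using insert.hyps odds_prod_pos by (simp add: less_imp_le sum_nonneg)
      with insert show ?case by simp
    qed simp
    finally show "exit_left \<omega> (x - int a) (x + int b) x \<le> (\<Sum>k<b. min 1 (odds_prod \<omega> s (a + k)))"
      by simp
  qed (use integrable_exit_left[OF ab] int in auto)
  also have "\<dots> = (\<Sum>k<b. \<integral>\<omega>. min 1 (odds_prod \<omega> s (a + k)) \<partial>env_law \<mu>)"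
    using int by simp
  also have "\<dots> \<le> (\<Sum>k<b. r ^ (a + k))" by (intro sum_mono decay)
  also have "\<dots> = r ^ a * ((1 - r ^ b) / (1 - r))"
    using r sum_gp_strict[of r b] by (simp add: power_add flip: sum_distrib_left)
  also have "\<dots> \<le> r ^ a * (1 / (1 - r))"
    using r by (intro mult_left_mono divide_right_mono) auto
  finally show ?thesis by simp
qed

end

section \<open>Annealed probabilities\<close>

context iid_environment
begin

lemma sets_annealed: "sets (annealed \<mu> x) = sets (env_law \<mu> \<Otimes>\<^sub>M path_space)"
  unfolding annealed_def by (rule sets_bind[OF _ E.not_empty]) auto

lemma space_annealed: "space (annealed \<mu> x) = space (env_law \<mu>) \<times> UNIV"
  using sets_eq_imp_space_eq[OF sets_annealed] by (simp add: space_pair_measure space_PiM)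

lemma path_prob_measurable:
  assumes "A \<in> sets path_space"
  shows "(\<lambda>\<omega>. measure (quenched x \<omega>) A) \<in> borel_measurable (env_law \<mu>)"
  using measurable_compose[OF measurable_quenched[OF site_law, of x] measurable_measure_subprob_algebra[OF assms]]
    \<kappa>_pos by simp

lemma integrable_path_prob:
  assumes "A \<in> sets path_space"
  shows "integrable (env_law \<mu>) (\<lambda>\<omega>. measure (quenched x \<omega>) A)"
  using path_prob_measurable[OF assms] prob_space.prob_le_1[OF environment.prob_space_quenched'[OF environment]]
  by (intro E.integrable_bounded[of _ 1]) auto

definition path_law :: "int \<Rightarrow> (nat \<Rightarrow> int) measure" where
  "path_law x = distr (annealed \<mu> x) path_space snd"

lemma snd_measurable_annealed [measurable]: "snd \<in> measurable (annealed \<mu> x) path_space"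
  using measurable_cong_sets[OF sets_annealed refl] measurable_snd by blast

lemma emeasure_path_law:
  assumes A: "A \<in> sets path_space"
  shows "emeasure (path_law x) A = ennreal (\<integral>\<omega>. measure (quenched x \<omega>) A \<partial>env_law \<mu>)"
proof -
  let ?A = "space (env_law \<mu>) \<times> A"
  have "snd -` A \<inter> space (annealed \<mu> x) = ?A"
    by (auto simp: space_annealed)
  then have "emeasure (path_law x) A = emeasure (annealed \<mu> x) ?A"
    unfolding path_law_def using A by (simp add: emeasure_distr)
  also have "\<dots> = (\<integral>\<^sup>+\<omega>. emeasure (quenched x \<omega>) {X. (\<omega>, X) \<in> ?A} \<partial>env_law \<mu>)"
    using A \<kappa>_pos by (intro emeasure_annealed[OF site_law]) auto
  also have "\<dots> = (\<integral>\<^sup>+\<omega>. ennreal (measure (quenched x \<omega>) A) \<partial>env_law \<mu>)"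
  proof (rule nn_integral_cong)
    fix \<omega> assume \<omega>: "\<omega> \<in> space (env_law \<mu>)"
    interpret prob_space "quenched x \<omega>"
      by (rule environment.prob_space_quenched'[OF environment[OF \<omega>]])
    show "emeasure (quenched x \<omega>) {X. (\<omega>, X) \<in> ?A} = ennreal (measure (quenched x \<omega>) A)"
      using \<omega> by (simp add: emeasure_eq_measure)
  qed
  also have "\<dots> = ennreal (\<integral>\<omega>. measure (quenched x \<omega>) A \<partial>env_law \<mu>)"
    using integrable_path_prob[OF A] by (intro nn_integral_eq_integral) auto
  finally show ?thesis .
qed

lemma measure_path_law:
  "A \<in> sets path_space \<Longrightarrow> measure (path_law x) A = (\<integral>\<omega>. measure (quenched x \<omega>) A \<partial>env_law \<mu>)"
  by (simp add: measure_def emeasure_path_law integral_nonneg_AE)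

lemma sets_path_law [measurable_cong]: "sets (path_law x) = sets path_space"
  by (simp add: path_law_def)

lemma space_path_law: "space (path_law x) = UNIV"
  by (simp add: path_law_def space_PiM)

lemma prob_space_path_law: "prob_space (path_law x)"
proof (rule prob_spaceI)
  have "(\<integral>\<omega>. measure (quenched x \<omega>) UNIV \<partial>env_law \<mu>) = (\<integral>\<omega>. 1 \<partial>env_law \<mu>)"
    using environment.measure_quenched_UNIV[OF environment]
    by (intro Bochner_Integration.integral_cong) auto
  moreover have "UNIV \<in> sets path_space"
    using sets.top[of path_space] by (simp add: space_PiM)
  ultimately show "emeasure (path_law x) (space (path_law x)) = 1"
    by (simp add: space_path_law emeasure_path_law E.prob_space)
qed

lemma annealed_prob:
  assumes "{X. P X} \<in> sets path_space"
  shows "\<P>((\<omega>, X) in annealed \<mu> x. P X) = measure (path_law x) {X. P X}"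
proof -
  have "snd -` {X. P X} \<inter> space (annealed \<mu> x) = {(\<omega>, X) \<in> space (annealed \<mu> x). P X}"
    by auto
  then show ?thesis
    unfolding path_law_def using measure_distr[OF snd_measurable_annealed assms] by simp
qed

definition exit_prob :: "nat \<Rightarrow> nat \<Rightarrow> real" where
  "exit_prob a b = (\<integral>\<omega>. exit_left \<omega> (- int a) (int b) 0 \<partial>env_law \<mu>)"

lemma path_law_exit:
  assumes "0 < a" "0 < b" "- int a \<in> D" "int b \<notin> D" "D \<inter> {- int a<..<int b} = {}"
  shows "measure (path_law 0) {X. reaches_within {- int a<..<int b} D X} = exit_prob a b"
  unfolding measure_path_law[OF reaches_within_in_sets] exit_prob_def
  using assms environment.reaches_within_eq_exit_left[OF environment]
  by (intro Bochner_Integration.integral_cong) auto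

lemma path_law_exit_left:
  "0 < a \<Longrightarrow> 0 < b \<Longrightarrow>
    measure (path_law 0) {X. reaches_within {- int a<..<int b} {..- int a} X} = exit_prob a b"
  by (intro path_law_exit) auto

lemma exit_prob_nonneg: "0 \<le> exit_prob a b"
  unfolding exit_prob_def using exit_left_bounds by (intro Bochner_Integration.integral_nonneg_AE) auto

lemma exit_prob_not_small: "0 \<le> drift \<Longrightarrow> 0 < a \<Longrightarrow> a \<le> b \<Longrightarrow> exit_bound \<kappa> \<le> exit_prob a b"
  unfolding exit_prob_def by (rule exit_left_not_small)

lemma exit_prob_decay:
  assumes "drift < 0"
  obtains r where "0 < r" "r < 1" "\<And>a b. 0 < a \<Longrightarrow> 0 < b \<Longrightarrow> exit_prob a b \<le> r ^ a / (1 - r)"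
proof -
  obtain r where r: "0 < r" "r < 1"
      "\<And>s k. (\<integral>\<omega>. min 1 (odds_prod \<omega> s k) \<partial>env_law \<mu>) \<le> r ^ k"
    using truncated_odds_prod_decay[OF assms] by blast
  have "exit_prob a b \<le> r ^ a / (1 - r)" if "0 < a" "0 < b" for a b
    unfolding exit_prob_def using exit_left_decay[OF r that, of 0] by simp
  then show thesis using that r by blast
qed

section \<open>Each condition is equivalent to a negative drift\<close>

lemma exits_U_box:
  assumes "0 < L"
  defines "n \<equiv> nat \<lceil>L\<rceil>"
  shows "\<P>((\<omega>, X) in annealed \<mu> 0. exits_outside (U_box L) (U_right L) X) = exit_prob n n"
    and "0 < n" "L \<le> real n"
proof -
  have n: "int n = \<lceil>L\<rceil>" "0 < n" using assms by (auto simp: n_def)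
  then show "0 < n" "L \<le> real n"
    using le_of_int_ceiling[of L] by (simp_all flip: n(1))
  have U: "U_box L = {- int n<..<int n}"
  proof (intro set_eqI)
    fix x :: int
    have "x < \<lceil>L\<rceil> \<longleftrightarrow> of_int x < L" "- x < \<lceil>L\<rceil> \<longleftrightarrow> - of_int x < L"
      using less_ceiling_iff[of x L] less_ceiling_iff[of "- x" L] by simp_all
    then show "x \<in> U_box L \<longleftrightarrow> x \<in> {- int n<..<int n}"
      unfolding U_box_def n(1) by (auto simp: abs_less_iff)
  qed
  have "int n - 1 \<in> U_box L" using n by (simp add: U)
  then have right: "int n \<in> boundary (U_box L)"
    unfolding boundary_def U by (auto intro!: bexI[of _ "int n - 1"])
  have D: "- int n \<in> - U_box L \<inter> - U_right L" "int n \<notin> - U_box L \<inter> - U_right L"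
    using right \<open>L \<le> real n\<close> assms(1) by (auto simp: U_right_def) (auto simp: U)
  show "\<P>((\<omega>, X) in annealed \<mu> 0. exits_outside (U_box L) (U_right L) X) = exit_prob n n"
    unfolding exits_outside_iff annealed_prob[OF reaches_within_in_sets]
    using path_law_exit[OF n(2) n(2) D] by (simp add: U)
qed

text \<open>A nonnegative drift keeps the exit probability at or above \<^term>\<open>exit_bound \<kappa>\<close> for all \<open>L\<close>.
  A negative drift makes it decay exponentially, for which any \<open>\<phi>\<close> of order \<open>1 / L\<close> is large enough.\<close>

lemma cond_decay_iff: "cond_decay \<mu> \<longleftrightarrow> drift < 0"
proof
  assume "cond_decay \<mu>"
  then obtain L0 and \<phi> :: "ennreal \<Rightarrow> ennreal" where \<phi>: "(\<phi> \<longlongrightarrow> 0) (at \<infinity>)"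
    and le: "\<And>L. L0 \<le> L \<Longrightarrow>
      ennreal (\<P>((\<omega>, X) in annealed \<mu> 0. exits_outside (U_box L) (U_right L) X)) \<le> \<phi> (ennreal L)"
    by (auto simp: cond_decay_def)
  show "drift < 0"
  proof (rule ccontr)
    assume "\<not> drift < 0"
    have "filterlim (\<lambda>n. ennreal (real n)) (at \<infinity>) sequentially"
      unfolding filterlim_at
      using of_nat_tendsto_top_ennreal by (auto simp: infinity_ennreal_def ennreal_of_nat_eq_real_of_nat)
    from filterlim_compose[OF \<phi> this] have "(\<lambda>n. \<phi> (ennreal (real n))) \<longlonglongrightarrow> 0" .
    from order_tendstoD(2)[OF this, of "ennreal (exit_bound \<kappa>)"]
    have "\<forall>\<^sub>F n in sequentially. \<phi> (ennreal (real n)) < ennreal (exit_bound \<kappa>)"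
      using exit_bound_pos by simp
    moreover have "\<forall>\<^sub>F n in sequentially. max 1 (nat \<lceil>L0\<rceil>) \<le> n"
      by (rule eventually_ge_at_top)
    ultimately obtain n where n: "\<phi> (ennreal (real n)) < ennreal (exit_bound \<kappa>)" "max 1 (nat \<lceil>L0\<rceil>) \<le> n"
      by (auto dest: eventually_happens[OF eventually_conj])
    then have L: "L0 \<le> real n" "0 < real n" by (auto simp: nat_le_iff ceiling_le_iff)
    have "ennreal (exit_bound \<kappa>) \<le> ennreal (exit_prob n n)"
      using \<open>\<not> drift < 0\<close> L by (intro ennreal_leI exit_prob_not_small) auto
    also have "\<dots> \<le> \<phi> (ennreal (real n))"
      using le[OF L(1)] exits_U_box[OF L(2)] by simp
    finally show False using n(1) by simp
  qed
next
  assume "drift < 0"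
  then obtain r where r: "0 < r" "r < 1" and
    decay: "\<And>a b. 0 < a \<Longrightarrow> 0 < b \<Longrightarrow> exit_prob a b \<le> r ^ a / (1 - r)"
    using exit_prob_decay by blast
  define K where "K = 1 / (1 - r)\<^sup>2"
  have K: "0 < K" using r by (simp add: K_def)
  define \<phi> where "\<phi> = (\<lambda>y. ennreal K * inverse y)"
  have "(\<phi> \<longlongrightarrow> ennreal K * inverse \<infinity>) (at \<infinity>)"
  proof -
    have "isCont (inverse :: ennreal \<Rightarrow> ennreal) \<infinity>"
      using continuous_on_inverse_ennreal[of UNIV "\<lambda>y. y"] by (simp add: continuous_on_eq_continuous_at)
    then show ?thesis
      unfolding \<phi>_def isCont_def by (intro ennreal_tendsto_cmult) auto
  qed
  then have lim: "(\<phi> \<longlongrightarrow> 0) (at \<infinity>)" by (simp add: infinity_ennreal_def)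
  have "ennreal (\<P>((\<omega>, X) in annealed \<mu> 0. exits_outside (U_box L) (U_right L) X)) \<le> \<phi> (ennreal L)"
    if L: "1 \<le> L" for L
  proof -
    have "0 < L" using L by simp
    note n = exits_U_box[OF this]
    let ?n = "nat \<lceil>L\<rceil>"
    have "real ?n * r ^ ?n = (\<Sum>k<?n. r ^ ?n)" by simp
    also have "\<dots> \<le> (\<Sum>k<?n. r ^ k)"
      using r by (intro sum_mono power_decreasing) auto
    also have "\<dots> \<le> 1 / (1 - r)"
      using r sum_gp_strict[of r ?n] by (simp add: divide_right_mono)
    finally have "L * r ^ ?n \<le> 1 / (1 - r)"
      using n(3) r by (meson mult_right_mono order_trans zero_le_power less_imp_le)
    then have "r ^ ?n \<le> (1 / (1 - r)) / L"
      by (simp only: pos_le_divide_eq[OF \<open>0 < L\<close>] mult.commute)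
    then have "r ^ ?n / (1 - r) \<le> (1 / (1 - r)) / L / (1 - r)"
      using r by (intro divide_right_mono) auto
    also have "\<dots> = K * inverse L"
      by (simp add: K_def power2_eq_square divide_inverse)
    finally have "exit_prob ?n ?n \<le> K * inverse L"
      using decay[OF n(2) n(2)] by simp
    then show ?thesis
      using n(1) K \<open>0 < L\<close> by (simp add: \<phi>_def inverse_ennreal flip: ennreal_mult)
  qed
  then show "cond_decay \<mu>"
    unfolding cond_decay_def using lim by (intro exI[of _ 1] conjI exI[of _ \<phi>]) auto
qed

text \<open>The probability of a left exit decreases in the starting point, so the supremum is attained at
  the left end \<open>0\<close> of the inner box.\<close>

lemma cond_W_iff_exit_prob:
  assumes "0 < M"
  shows "cond_W lam \<mu> c M \<longleftrightarrow> exit_prob (nat \<lceil>M\<rceil>) (nat \<lceil>(1 + 1 / 11) * M\<rceil>) < lam"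
proof -
  define a where "a = nat \<lceil>M\<rceil>"
  define b where "b = nat \<lceil>(1 + 1 / 11) * M\<rceil>"
  let ?N = "(1 + 1 / 11) * M"
  have N: "0 < ?N" "M < ?N" using assms by simp_all
  have ab: "int a = \<lceil>M\<rceil>" "int b = \<lceil>?N\<rceil>" "0 < a" "0 < b"
    using assms N by (auto simp: a_def b_def)
  have B2: "B2 c M = {- int a<..<int b}"
  proof (intro set_eqI)
    fix x :: int
    show "x \<in> B2 c M \<longleftrightarrow> x \<in> {- int a<..<int b}"
      using less_ceiling_iff[of x ?N] less_ceiling_iff[of "- x" M] unfolding B2_def ab by auto
  qed
  have "real_of_int (int b) \<ge> ?N"
    using le_of_int_ceiling[of ?N] unfolding ab(2) .
  moreover have "int b - 1 \<in> B2 c M" using ab by (simp add: B2)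
  then have "int b \<in> boundary (B2 c M)"
    unfolding boundary_def B2 by (auto intro!: bexI[of _ "int b - 1"])
  ultimately have D: "- int a \<in> - B2 c M \<inter> - B2_right c M" "int b \<notin> - B2 c M \<inter> - B2_right c M"
    using N(1) by (auto simp: B2_right_def) (auto simp: B2)
  have "(SUP x\<in>B1 c M. \<P>(X in quenched x \<omega>. exits_outside (B2 c M) (B2_right c M) X)) =
      exit_left \<omega> (- int a) (int b) 0" if \<omega>: "\<omega> \<in> space (env_law \<mu>)" for \<omega>
  proof -
    interpret environment \<kappa> \<omega> by (rule environment[OF \<omega>])
    have B1: "- int a < x \<and> x < int b \<and> 0 \<le> x" if "x \<in> B1 c M" for x
      using that N less_ceiling_iff[of x ?N] unfolding ab(2) B1_def using ab(3) by auto
    have eq: "\<P>(X in quenched x \<omega>. exits_outside (B2 c M) (B2_right c M) X) = exit_left \<omega> (- int a) (int b) x"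
      if "x \<in> B1 c M" for x
      using reaches_within_eq_exit_left[of "- int a" x "int b", OF _ _ D] B1[OF that]
      by (simp add: exits_outside_iff space_quenched[OF range \<kappa>_nonneg] B2)
    have "(SUP x\<in>B1 c M. \<P>(X in quenched x \<omega>. exits_outside (B2 c M) (B2_right c M) X)) =
        (SUP x\<in>B1 c M. exit_left \<omega> (- int a) (int b) x)"
      using eq by (intro SUP_cong) auto
    also have "\<dots> = exit_left \<omega> (- int a) (int b) 0"
    proof (rule cSup_eq_maximum)
      show "exit_left \<omega> (- int a) (int b) 0 \<in> exit_left \<omega> (- int a) (int b) ` B1 c M"
        using assms by (intro imageI) (simp add: B1_def)
      show "y \<le> exit_left \<omega> (- int a) (int b) 0"
        if "y \<in> exit_left \<omega> (- int a) (int b) ` B1 c M" for y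
        using that B1 exit_left_ratio(2)[OF ab(3,4), of 0] by force
    qed
    finally show ?thesis .
  qed
  then have "(\<integral>\<omega>. (SUP x\<in>B1 c M. \<P>(X in quenched x \<omega>. exits_outside (B2 c M) (B2_right c M) X)) \<partial>env_law \<mu>)
      = exit_prob a b"
    unfolding exit_prob_def by (intro Bochner_Integration.integral_cong) auto
  then show ?thesis by (simp add: cond_W_def a_def b_def)
qed

text \<open>The outer box is wider on the right than on the left, as \<open>exit_prob_not_small\<close> requires.\<close>

lemma cond_W_iff: "(\<exists>c>0. \<exists>M>1 / exit_bound \<kappa>. cond_W (exit_bound \<kappa>) \<mu> c M) \<longleftrightarrow> drift < 0"
proof
  assume "\<exists>c>0. \<exists>M>1 / exit_bound \<kappa>. cond_W (exit_bound \<kappa>) \<mu> c M"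
  then obtain c M where M: "1 / exit_bound \<kappa> < M" and W: "cond_W (exit_bound \<kappa>) \<mu> c M" by auto
  have "0 < M" using M exit_bound_pos[of \<kappa>] by (meson less_trans zero_less_divide_1_iff)
  with W have "exit_prob (nat \<lceil>M\<rceil>) (nat \<lceil>(1 + 1 / 11) * M\<rceil>) < exit_bound \<kappa>"
    by (simp add: cond_W_iff_exit_prob)
  moreover have "M \<le> (1 + 1 / 11) * M" using \<open>0 < M\<close> by simp
  then have "nat \<lceil>M\<rceil> \<le> nat \<lceil>(1 + 1 / 11) * M\<rceil>" by (intro nat_mono ceiling_mono)
  moreover have "0 < nat \<lceil>M\<rceil>" using \<open>0 < M\<close> by simp
  ultimately show "drift < 0"
    using exit_prob_not_small by (meson not_le)
next
  assume "drift < 0"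
  then obtain r where r: "0 < r" "r < 1" and
    decay: "\<And>a b. 0 < a \<Longrightarrow> 0 < b \<Longrightarrow> exit_prob a b \<le> r ^ a / (1 - r)"
    using exit_prob_decay by blast
  have "(\<lambda>n. r ^ n / (1 - r)) \<longlonglongrightarrow> 0 / (1 - r)"
    using r by (intro tendsto_divide LIMSEQ_power_zero) auto
  then have "\<forall>\<^sub>F n in sequentially. r ^ n / (1 - r) < exit_bound \<kappa>"
    using order_tendstoD(2)[of _ 0 sequentially "exit_bound \<kappa>"] exit_bound_pos by simp
  moreover have "\<forall>\<^sub>F n in sequentially. nat \<lceil>1 / exit_bound \<kappa>\<rceil> + 1 \<le> n"
    by (rule eventually_ge_at_top)
  ultimately obtain n where n: "r ^ n / (1 - r) < exit_bound \<kappa>" "nat \<lceil>1 / exit_bound \<kappa>\<rceil> + 1 \<le> n"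
    using eventually_happens'[OF sequentially_bot eventually_conj] by blast
  have M: "1 / exit_bound \<kappa> < real n" "0 < n"
    using n(2) real_nat_ceiling_ge[of "1 / exit_bound \<kappa>"] by linarith+
  have "0 < nat \<lceil>(1 + 1 / 11) * real n\<rceil>" using M(2) by simp
  from decay[OF M(2) this] n(1) have "cond_W (exit_bound \<kappa>) \<mu> 1 (real n)"
    using M(2) by (simp add: cond_W_iff_exit_prob)
  then show "\<exists>c>0. \<exists>M>1 / exit_bound \<kappa>. cond_W (exit_bound \<kappa>) \<mu> c M"
    using M(1) by (intro exI[of _ 1] conjI exI[of _ "real n"]) auto
qed

text \<open>In dimension one \<open>{1}\<close> is itself a neighbourhood of \<open>1\<close> in the sphere, so only \<open>\<ell>' = 1\<close> has to be
  considered. A probability bounded away from zero has a vanishing exponential rate.\<close>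

lemma cond_T_iff: "cond_T \<mu> \<longleftrightarrow> drift < 0"
proof -
  define p where "p b L = \<P>((\<omega>, X) in annealed \<mu> 0. hit_le 1 (- b * L) X < hit_ge 1 L X)" for b L
  have p: "p b L = exit_prob (nat \<lceil>b * L\<rceil>) (nat \<lceil>L\<rceil>)" if "0 < b" "0 < L" for b L
  proof -
    let ?a = "nat \<lceil>b * L\<rceil>" and ?n = "nat \<lceil>L\<rceil>"
    have "0 < b * L" using that by simp
    have pos: "int (nat z) = z" "0 < nat z" if "0 < z" for z :: int using that by auto
    have "0 < \<lceil>b * L\<rceil>" "0 < \<lceil>L\<rceil>"
      unfolding zero_less_ceiling by fact+
    note a = pos[OF this(1)] and n = pos[OF this(2)]
    have lo: "- b * L < of_int x \<longleftrightarrow> - int ?a < x" for x :: int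
      using less_ceiling_iff[of "- x" "b * L"] unfolding a(1) by auto
    have hi: "of_int x < L \<longleftrightarrow> x < int ?n" for x :: int
      using less_ceiling_iff[of x L] unfolding n(1) by auto
    have "of_int x \<le> - b * L \<longleftrightarrow> x \<le> - int ?a" for x :: int
      using lo[of x] by (simp add: not_less[symmetric])
    then have sets: "{x :: int. of_int x \<le> - b * L} = {..- int ?a}"
      "{x :: int. - b * L < of_int x \<and> of_int x < L} = {- int ?a<..<int ?n}"
      using lo hi by auto
    have "- b * L < L" using \<open>0 < b * L\<close> that by linarith
    show ?thesis
      unfolding p_def hit_le_less_hit_ge_iff[OF \<open>- b * L < L\<close>] annealed_prob[OF reaches_within_in_sets]
        sets using path_law_exit_left[OF a(2) n(2)] .
  qed
  define f where "f b L = ereal (1 / L) * elog (p b L)" for b L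
  have T: "cond_T \<mu> \<longleftrightarrow> (\<forall>b>0. \<exists>U. openin (top_of_set (sphere (0::real) 1)) U \<and> 1 \<in> U \<and>
      (\<forall>l\<in>U. Limsup at_top (\<lambda>L::real. ereal (1 / L) *
         elog (\<P>((\<omega>, X) in annealed \<mu> 0. hit_le l (- b * L) X < hit_ge l L X))) < 0))"
    by (rule cond_T_def)
  show ?thesis
  proof
    assume "cond_T \<mu>"
    from this[unfolded T, rule_format, OF zero_less_one] obtain U where U: "1 \<in> U"
      "\<forall>l\<in>U. Limsup at_top (\<lambda>L::real. ereal (1 / L) *
         elog (\<P>((\<omega>, X) in annealed \<mu> 0. hit_le l (- 1 * L) X < hit_ge l L X))) < 0" by blast
    have neg: "Limsup at_top (f 1) < 0"
      using bspec[OF U(2) U(1)] unfolding f_def p_def .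
    show "drift < 0"
    proof (rule ccontr)
      assume "\<not> drift < 0"
      have "\<forall>\<^sub>F L in at_top. ereal (ln (exit_bound \<kappa>) / L) \<le> f 1 L"
        using eventually_gt_at_top[of 0]
      proof eventually_elim
        fix L :: real assume L: "0 < L"
        have low: "exit_bound \<kappa> \<le> p 1 L"
          using p[of 1 L] L exit_prob_not_small[of "nat \<lceil>L\<rceil>" "nat \<lceil>L\<rceil>"] \<open>\<not> drift < 0\<close> by simp
        then have "0 < p 1 L" "ln (exit_bound \<kappa>) \<le> ln (p 1 L)"
          using exit_bound_pos[of \<kappa>] by (auto simp: less_le_trans)
        then show "ereal (ln (exit_bound \<kappa>) / L) \<le> f 1 L"
          using L by (simp add: f_def elog_def divide_right_mono)
      qed
      from Limsup_mono[OF this]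
      have "Limsup at_top (\<lambda>L. ereal (ln (exit_bound \<kappa>) / L)) \<le> Limsup at_top (f 1)" .
      moreover have "((\<lambda>L::real. ereal (ln (exit_bound \<kappa>) / L)) \<longlongrightarrow> ereal 0) at_top"
        by (intro tendsto_ereal tendsto_divide_0[OF tendsto_const] filterlim_at_top_imp_at_infinity
            filterlim_ident)
      from lim_imp_Limsup[OF _ this] have "Limsup at_top (\<lambda>L::real. ereal (ln (exit_bound \<kappa>) / L)) = 0"
        by simp
      ultimately show False using neg by simp
    qed
  next
    assume "drift < 0"
    then obtain r where r: "0 < r" "r < 1" and
      decay: "\<And>a b. 0 < a \<Longrightarrow> 0 < b \<Longrightarrow> exit_prob a b \<le> r ^ a / (1 - r)"
      using exit_prob_decay by blast
    have "Limsup at_top (f b) < 0" if b: "0 < b" for b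
    proof -
      define c where "c = - b * ln r / 2"
      have c: "0 < c" using b r by (simp add: c_def mult_pos_neg)
      have "\<forall>\<^sub>F L in at_top. f b L \<le> ereal (- c)"
        using eventually_gt_at_top[of 0] eventually_ge_at_top[of "- ln (1 - r) / c"]
      proof eventually_elim
        fix L :: real assume L: "0 < L" "- ln (1 - r) / c \<le> L"
        show "f b L \<le> ereal (- c)"
        proof (cases "p b L = 0")
          case True
          then show ?thesis using L by (simp add: f_def elog_def)
        next
          case False
          let ?a = "nat \<lceil>b * L\<rceil>"
          have bL: "0 < b * L" using b L by simp
          have "0 < p b L"
            using False p[OF b L(1)] exit_prob_nonneg[of ?a "nat \<lceil>L\<rceil>"] by simp
          moreover have "p b L \<le> r ^ ?a / (1 - r)"
            unfolding p[OF b L(1)] using bL L by (intro decay) auto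
          ultimately have "ln (p b L) \<le> ln (r ^ ?a / (1 - r))"
            by (simp only: ln_mono)
          also have "\<dots> = real ?a * ln r - ln (1 - r)"
            using r by (simp add: ln_div ln_realpow)
          also have "real ?a * ln r \<le> b * L * ln r"
            using r real_nat_ceiling_ge[of "b * L"] by (intro mult_right_mono_neg) auto
          also have "b * L * ln r = - 2 * c * L" by (simp add: c_def)
          also have "- 2 * c * L - ln (1 - r) \<le> - c * L"
            using L(2) unfolding pos_divide_le_eq[OF c] by (simp add: mult.commute)
          finally have "ln (p b L) / L \<le> - c"
            using L(1) by (simp add: divide_le_eq)
          then show ?thesis using False by (simp add: f_def elog_def)
        qed
      qed
      from Limsup_bounded[OF this] have "Limsup at_top (f b) \<le> ereal (- c)" .
      also have "\<dots> < 0" using c by simp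
      finally show ?thesis .
    qed
    moreover have "openin (top_of_set (sphere (0::real) 1)) {1}"
    proof -
      have "openin (top_of_set (sphere (0::real) 1)) (sphere 0 1 \<inter> {0<..})"
        by (rule openin_open_Int) simp
      also have "sphere (0::real) 1 \<inter> {0<..} = {1}" by auto
      finally show ?thesis .
    qed
    ultimately show "cond_T \<mu>"
      unfolding T f_def p_def by (intro allI impI exI[of _ "{1}"]) auto
  qed
qed

section \<open>Transience\<close>

lemma path_coordinate_measurable [measurable]: "(\<lambda>X :: nat \<Rightarrow> int. X n) \<in> borel_measurable path_space"
  using measurable_compose[OF measurable_component_singleton[of n UNIV "\<lambda>_. count_space UNIV"],
      of "\<lambda>x :: int. x" borel] by simp

lemma transient_set:
  "{X :: nat \<Rightarrow> int. filterlim X at_top sequentially} \<in> sets path_space"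
proof -
  have "{X :: nat \<Rightarrow> int. filterlim X at_top sequentially} =
      {X \<in> space path_space. \<forall>y. \<exists>N. \<forall>n. N \<le> n \<longrightarrow> y \<le> X n}"
    by (auto simp: filterlim_at_top eventually_sequentially space_PiM)
  also have "\<dots> \<in> sets path_space" by measurable
  finally show ?thesis .
qed

text \<open>A path that tends to infinity is bounded below, so under transience the probability of ever
  reaching \<open>- n\<close> tends to zero; it would not fall below \<^term>\<open>exit_bound \<kappa>\<close> for a nonnegative drift.\<close>

lemma transient_right_imp_negative_drift:
  assumes "transient_right \<mu>"
  shows "drift < 0"
proof (rule ccontr)
  assume drift: "\<not> drift < 0"
  interpret W: prob_space "path_law 0" by (rule prob_space_path_law)
  define S where "S n = {X :: nat \<Rightarrow> int. \<exists>k. X k \<le> - int n}" for n :: nat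
  have S_sets [measurable]: "S n \<in> W.events" for n
  proof -
    have "S n = {X \<in> space path_space. \<exists>k. X k \<le> - int n}" by (simp add: S_def space_PiM)
    also have "\<dots> \<in> sets path_space" by measurable
    finally show ?thesis by (simp add: sets_path_law)
  qed
  let ?Tr = "{X :: nat \<Rightarrow> int. filterlim X at_top sequentially}"
  have Tr_sets: "?Tr \<in> W.events" by (simp add: sets_path_law transient_set)
  have Tr: "W.prob ?Tr = 1"
    using assms annealed_prob[OF transient_set, of 0] by (simp add: transient_right_def)
  have disj: "(\<Inter>n. S n) \<subseteq> space (path_law 0) - ?Tr"
  proof
    fix X assume X: "X \<in> (\<Inter>n. S n)"
    have "\<not> filterlim X at_top sequentially"
    proof
      assume "filterlim X at_top sequentially"
      then have "\<forall>\<^sub>F n in sequentially. 0 \<le> X n" by (auto simp: filterlim_at_top)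
      then obtain N where N: "\<And>n. N \<le> n \<Longrightarrow> 0 \<le> X n" by (auto simp: eventually_sequentially)
      define m where "m = Min (insert 0 (X ` {..<N}))"
      have m: "m \<le> X k" "m \<le> 0" for k
      proof -
        show m0: "m \<le> 0" by (simp add: m_def)
        show "m \<le> X k"
        proof (cases "k < N")
          case True
          then show ?thesis by (simp add: m_def)
        next
          case False
          then show ?thesis using N[of k] m0 by simp
        qed
      qed
      have "X \<in> S (nat (1 - m))" using X by blast
      then obtain k where "X k \<le> - int (nat (1 - m))" by (auto simp: S_def)
      then show False using m(1)[of k] m(2) by simp
    qed
    then show "X \<in> space (path_law 0) - ?Tr" by (simp add: space_path_law)
  qed
  have "W.prob (\<Inter>n. S n) \<le> W.prob (space (path_law 0) - ?Tr)"
    using disj Tr_sets by (intro W.finite_measure_mono) auto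
  also have "\<dots> = 0"
    using W.prob_compl[OF Tr_sets] Tr by simp
  finally have "W.prob (\<Inter>n. S n) = 0" by (simp add: measure_le_0_iff)
  moreover have "(\<lambda>n. W.prob (S n)) \<longlonglongrightarrow> W.prob (\<Inter>n. S n)"
  proof (rule W.finite_Lim_measure_decseq)
    have "S n \<subseteq> S m" if "m \<le> n" for m n
    proof
      fix X assume "X \<in> S n"
      then obtain k where "X k \<le> - int n" by (auto simp: S_def)
      then have "X k \<le> - int m" using that by linarith
      then show "X \<in> S m" by (auto simp: S_def)
    qed
    then show "decseq S" by (auto simp: decseq_def)
  qed (use S_sets in auto)
  ultimately have "(\<lambda>n. W.prob (S n)) \<longlonglongrightarrow> 0" by simp
  moreover have "\<exists>N. \<forall>n\<ge>N. exit_bound \<kappa> \<le> W.prob (S n)"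
  proof (intro exI[of _ 1] allI impI)
    fix n :: nat assume n: "1 \<le> n"
    have "exit_bound \<kappa> \<le> exit_prob n n"
      using drift n by (intro exit_prob_not_small) auto
    also have "\<dots> = W.prob {X. reaches_within {- int n<..<int n} {..- int n} X}"
      using n by (intro path_law_exit_left[symmetric]) auto
    also have "\<dots> \<le> W.prob (S n)"
      by (rule W.finite_measure_mono[OF _ S_sets]) (auto simp: S_def reaches_within_def)
    finally show "exit_bound \<kappa> \<le> W.prob (S n)" .
  qed
  ultimately have "exit_bound \<kappa> \<le> 0" by (rule LIMSEQ_le_const)
  then show False using exit_bound_pos[of \<kappa>] by simp
qed

definition often_below :: "int \<Rightarrow> (nat \<Rightarrow> int) set" where
  "often_below y = {X. \<forall>N. \<exists>n\<ge>N. X n \<le> y}"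

lemma often_below_in_sets: "often_below y \<in> sets path_space"
proof -
  have "often_below y = {X \<in> space path_space. \<forall>N. \<exists>n. N \<le> n \<and> X n \<le> y}"
    by (auto simp: often_below_def space_PiM)
  also have "\<dots> \<in> sets path_space" by measurable
  finally show ?thesis .
qed

lemma often_below_shift: "case_nat x -` often_below y = often_below y"
proof (intro set_eqI iffI)
  fix X assume X: "X \<in> case_nat x -` often_below y"
  show "X \<in> often_below y"
    unfolding often_below_def
  proof safe
    fix N
    from X obtain n where n: "Suc N \<le> n" "case_nat x X n \<le> y"
      unfolding often_below_def by blast
    then show "\<exists>n\<ge>N. X n \<le> y" by (cases n) auto
  qed
next
  fix X assume X: "X \<in> often_below y"
  have "\<exists>n\<ge>N. case_nat x X n \<le> y" for N
  proof -
    from X obtain n where "N \<le> n" "X n \<le> y"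
      unfolding often_below_def by blast
    then show ?thesis by (intro exI[of _ "Suc n"]) simp
  qed
  then show "X \<in> case_nat x -` often_below y" by (simp add: often_below_def)
qed

text \<open>The event does not depend on the first step, so its quenched probability is harmonic on all of
  the integers. Its increment at \<open>x\<close> is the increment \<open>k\<close> sites further to the left, which is at
  most one in absolute value, times an odds product over \<open>k\<close> sites, which is small.\<close>

lemma often_below_start:
  assumes "drift < 0"
  shows "measure (path_law (x + 1)) (often_below y) = measure (path_law x) (often_below y)"
proof -
  obtain r where r: "0 < r" "r < 1"
      "\<And>s k. (\<integral>\<omega>. min 1 (odds_prod \<omega> s k) \<partial>env_law \<mu>) \<le> r ^ k"
    using truncated_odds_prod_decay[OF assms] by blast
  let ?u = "\<lambda>\<omega> x. measure (quenched x \<omega>) (often_below y)"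
  note int = integrable_path_prob[OF often_below_in_sets]
  have "(\<integral>\<omega>. \<bar>?u \<omega> x - ?u \<omega> (x + 1)\<bar> \<partial>env_law \<mu>) \<le> r ^ k" for k
  proof -
    let ?s = "x - int k + 1"
    have "(\<integral>\<omega>. \<bar>?u \<omega> x - ?u \<omega> (x + 1)\<bar> \<partial>env_law \<mu>) \<le> (\<integral>\<omega>. min 1 (odds_prod \<omega> ?s k) \<partial>env_law \<mu>)"
    proof (rule integral_mono)
      fix \<omega> assume \<omega>: "\<omega> \<in> space (env_law \<mu>)"
      interpret environment \<kappa> \<omega> by (rule environment[OF \<omega>])
      have bound: "\<bar>?u \<omega> a - ?u \<omega> b\<bar> \<le> 1" for a b
        using prob_space.prob_le_1[OF prob_space_quenched', of a "often_below y"]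
          prob_space.prob_le_1[OF prob_space_quenched', of b "often_below y"]
          measure_nonneg[of "quenched a \<omega>" "often_below y"]
          measure_nonneg[of "quenched b \<omega>" "often_below y"] by linarith
      have "?u \<omega> z = fst (\<omega> z) * ?u \<omega> (z + 1) + snd (\<omega> z) * ?u \<omega> (z - 1)" for z
        using first_step[OF often_below_in_sets] unfolding often_below_shift .
      then have "?u \<omega> (?s + int k - 1) - ?u \<omega> (?s + int k) =
          (?u \<omega> (?s - 1) - ?u \<omega> ?s) * odds_prod \<omega> ?s k"
        by (intro harmonic_increments)
      then have "\<bar>?u \<omega> x - ?u \<omega> (x + 1)\<bar> = \<bar>?u \<omega> (?s - 1) - ?u \<omega> ?s\<bar> * odds_prod \<omega> ?s k"
        using odds_prod_pos[of ?s k] by (simp add: abs_mult add.commute)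
      also have "\<dots> \<le> 1 * odds_prod \<omega> ?s k"
        using odds_prod_pos[of ?s k] bound by (intro mult_right_mono) auto
      finally show "\<bar>?u \<omega> x - ?u \<omega> (x + 1)\<bar> \<le> min 1 (odds_prod \<omega> ?s k)"
        using bound by simp
    qed (use int integrable_truncated_odds_prod in auto)
    also have "\<dots> \<le> r ^ k" by (rule r(3))
    finally show ?thesis .
  qed
  then have "(\<integral>\<omega>. \<bar>?u \<omega> x - ?u \<omega> (x + 1)\<bar> \<partial>env_law \<mu>) \<le> 0"
    using LIMSEQ_le_const[OF LIMSEQ_power_zero[of r]] r by auto
  moreover have "\<bar>\<integral>\<omega>. ?u \<omega> x - ?u \<omega> (x + 1) \<partial>env_law \<mu>\<bar> \<le> (\<integral>\<omega>. \<bar>?u \<omega> x - ?u \<omega> (x + 1)\<bar> \<partial>env_law \<mu>)"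
    by (rule integral_abs_bound)
  ultimately have "(\<integral>\<omega>. ?u \<omega> x - ?u \<omega> (x + 1) \<partial>env_law \<mu>) = 0" by linarith
  then show ?thesis
    using int by (simp add: measure_path_law[OF often_below_in_sets])
qed

text \<open>A path that is at or below \<open>y\<close> infinitely often visits \<open>{..y}\<close>, and until the first visit it stays in
  some bounded box; the bound on left exits is uniform in the right end of the box.\<close>

lemma often_below_decay:
  assumes "0 < r" "r < 1"
    "\<And>s k. (\<integral>\<omega>. min 1 (odds_prod \<omega> s k) \<partial>env_law \<mu>) \<le> r ^ k" and a: "0 < a"
  shows "measure (path_law (y + int a)) (often_below y) \<le> r ^ a / (1 - r)"
proof -
  interpret W: prob_space "path_law (y + int a)" by (rule prob_space_path_law)
  define R where "R b = {X. reaches_within {y<..<y + int a + int (Suc b)} {..y} X}" for b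
  have R_sets: "R b \<in> W.events" for b
    unfolding R_def by (simp add: sets_path_law reaches_within_in_sets)
  have "incseq R"
    unfolding incseq_def R_def reaches_within_def by fastforce
  then have "(\<lambda>b. W.prob (R b)) \<longlonglongrightarrow> W.prob (\<Union>b. R b)"
    using R_sets by (intro W.finite_Lim_measure_incseq) auto
  moreover have "W.prob (R b) \<le> r ^ a / (1 - r)" for b
  proof -
    have "W.prob (R b) = (\<integral>\<omega>. exit_left \<omega> ((y + int a) - int a) ((y + int a) + int (Suc b)) (y + int a) \<partial>env_law \<mu>)"
      by (simp only: R_def measure_path_law[OF reaches_within_in_sets] exit_left_def add_diff_cancel_right')
    also have "\<dots> \<le> r ^ a / (1 - r)"
      by (rule exit_left_decay[OF assms]) simp
    finally show ?thesis .
  qed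
  ultimately have union: "W.prob (\<Union>b. R b) \<le> r ^ a / (1 - r)"
    by (intro LIMSEQ_le_const2) auto
  have "often_below y \<subseteq> (\<Union>b. R b)"
  proof
    fix X assume "X \<in> often_below y"
    then have "{n. X n \<le> y} \<noteq> {}" by (auto simp: often_below_def)
    then obtain k where "k \<in> {n. X n \<le> y}" "\<And>m. m < k \<Longrightarrow> m \<notin> {n. X n \<le> y}"
      by (rule least_element) blast
    then have k: "X k \<le> y" "\<And>m. m < k \<Longrightarrow> y < X m" by (auto simp: not_le)
    define b where "b = nat (Max (insert 0 ((\<lambda>m. X m - y) ` {..<k})))"
    have "X m < y + int a + int (Suc b)" if "m < k" for m
    proof -
      have "X m - y \<le> Max (insert 0 ((\<lambda>m. X m - y) ` {..<k}))"
        using that by (intro Max_ge) auto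
      then show ?thesis unfolding b_def by linarith
    qed
    then have "X \<in> R b"
      unfolding R_def reaches_within_def using k by auto
    then show "X \<in> (\<Union>b. R b)" by blast
  qed
  then have "W.prob (often_below y) \<le> W.prob (\<Union>b. R b)"
    using R_sets by (intro W.finite_measure_mono) auto
  with union show ?thesis by simp
qed

text \<open>The probability of being at or below \<open>y\<close> infinitely often does not depend on the starting point, and it
  tends to zero as the starting point moves to the right; so it is zero.\<close>

lemma negative_drift_imp_transient_right:
  assumes "drift < 0"
  shows "transient_right \<mu>"
proof -
  interpret W: prob_space "path_law 0" by (rule prob_space_path_law)
  obtain r where r: "0 < r" "r < 1"
      "\<And>s k. (\<integral>\<omega>. min 1 (odds_prod \<omega> s k) \<partial>env_law \<mu>) \<le> r ^ k"
    using truncated_odds_prod_decay[OF assms] by blast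
  have never: "W.prob (often_below y) = 0" for y
  proof -
    have up: "measure (path_law (x + int n)) (often_below y) = measure (path_law x) (often_below y)" for x n
      by (induction n) (simp_all add: often_below_start[OF assms, of "x + int _"] add.assoc[symmetric] add.commute[of 1])
    have same: "measure (path_law x) (often_below y) = W.prob (often_below y)" for x
      using up[of 0 "nat x"] up[of x "nat (- x)"] by (cases "0 \<le> x") auto
    have "W.prob (often_below y) \<le> r ^ Suc k / (1 - r)" for k
      using often_below_decay[OF r, of "Suc k" y] unfolding same[of "y + int (Suc k)"] by simp
    moreover have "(\<lambda>k. r ^ Suc k) \<longlonglongrightarrow> 0"
      using r by (intro LIMSEQ_Suc[OF LIMSEQ_power_zero]) simp
    then have "(\<lambda>k. r ^ Suc k / (1 - r)) \<longlonglongrightarrow> 0 / (1 - r)"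
      using r by (intro tendsto_divide tendsto_const) auto
    ultimately have "W.prob (often_below y) \<le> 0 / (1 - r)"
      by (intro LIMSEQ_le_const) auto
    then show ?thesis by (simp add: measure_le_0_iff)
  qed
  have "AE X in path_law 0. \<forall>y. X \<notin> often_below y"
  proof (subst AE_all_countable, intro allI)
    fix y
    show "AE X in path_law 0. X \<notin> often_below y"
      using never[of y] often_below_in_sets[of y]
      by (intro AE_not_in) (auto simp: null_sets_def W.emeasure_eq_measure sets_path_law)
  qed
  then have "AE X in path_law 0. X \<in> {X. filterlim X at_top sequentially}"
  proof (rule AE_mp, intro AE_I2 impI)
    fix X :: "nat \<Rightarrow> int" assume X: "\<forall>y. X \<notin> often_below y"
    have "\<forall>\<^sub>F n in sequentially. y \<le> X n" for y
    proof -
      from X have "X \<notin> often_below (y - 1)" by blast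
      then obtain N where "\<And>n. N \<le> n \<Longrightarrow> \<not> X n \<le> y - 1" by (auto simp: often_below_def)
      then show ?thesis unfolding eventually_sequentially by (intro exI[of _ N]) force
    qed
    then show "X \<in> {X. filterlim X at_top sequentially}" by (simp add: filterlim_at_top)
  qed
  then have "W.prob {X. filterlim X at_top sequentially} = 1"
    using transient_set by (subst W.prob_eq_1) (auto simp: sets_path_law)
  then show ?thesis
    by (simp add: transient_right_def annealed_prob[OF transient_set])
qed

end

theorem corollary1p10:
  fixes \<kappa> :: real
  assumes "0 < \<kappa>" and "\<kappa> \<le> 1 / 2"
  shows "\<exists>lam::real. 0 < lam \<and> lam < 1 \<and>
    (\<forall>\<mu> :: (real \<times> real) measure. site_law \<kappa> \<mu> \<longrightarrow>
      (cond_decay \<mu> \<longleftrightarrow> (\<exists>c>0. \<exists>M>1 / lam. cond_W lam \<mu> c M)) \<and>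
      ((\<exists>c>0. \<exists>M>1 / lam. cond_W lam \<mu> c M) \<longleftrightarrow> transient_right \<mu>) \<and>
      (transient_right \<mu> \<longleftrightarrow> cond_T \<mu>))"
proof (intro exI[of _ "exit_bound \<kappa>"] conjI exit_bound_pos exit_bound_less_1 allI impI)
  fix \<mu> :: "(real \<times> real) measure"
  assume "site_law \<kappa> \<mu>"
  then interpret iid_environment \<kappa> \<mu> using assms(1) by unfold_locales
  have "transient_right \<mu> \<longleftrightarrow> drift < 0"
    using transient_right_imp_negative_drift negative_drift_imp_transient_right by blast
  then show "cond_decay \<mu> \<longleftrightarrow> (\<exists>c>0. \<exists>M>1 / exit_bound \<kappa>. cond_W (exit_bound \<kappa>) \<mu> c M)"
    "(\<exists>c>0. \<exists>M>1 / exit_bound \<kappa>. cond_W (exit_bound \<kappa>) \<mu> c M) \<longleftrightarrow> transient_right \<mu>"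
    "transient_right \<mu> \<longleftrightarrow> cond_T \<mu>"
    unfolding cond_decay_iff cond_W_iff cond_T_iff by simp_all
qed

end
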